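(* For every node $i\in V$ with $\mathcal S_C(i)\ne\emptyset$ and $\mathcal S_C(i)\ne\mathcal D_C$, $$\lim_{\nu\to\infty}\log_\nu\Big(\max_{s\in\mathcal D_C\setminus\mathcal S_C(i)}\mathbb E\,\tau_{s,\mathcal S_C(i)}(\nu)\Big)=\Upsilon_i(C)-1,$$ where $\Upsilon_i(C)=\max_{s\in\mathcal D_C\setminus\mathcal S_C(i)}\ \min_{s'\in\mathcal S_C(i)}\Delta(s,s')$ is the starvation index of node $i$.
   Context: Let $V=\{1,\dots,N\}$ be a finite set of nodes and $C\ge1$ the number of channels. For each $c\in\{1,\dots,C\}$ let $G_c=(V,E_c)$ be a simple undirected graph (the conflict graphs may differ for different $c$). The set of feasible states is $$\mathcal X_C=\{x\in\{0,1,\dots,C\}^N:\ \text{for every } c\in\{1,\dots,C\}\text{ and every }(i,j)\in E_c,\ \text{not both } x_i=c\text{ and }x_j=c\}.$$ For a parameter $\nu>1$, $\{X_C(t)\}_{t\ge0}$ is the continuous-time Markov process on $\mathcal X_C$ with homogeneous transition rates, for $x\neq y$: $q_C(x,y)=\nu$ if $x_i=0$ and $y=x+c\,e_i$ for some $i\in V$, $1\le c\le C$; $q_C(x,y)=1$ if $x_i=c\ge 1$ and $y=x-c\,e_i$ for some $i\in V$, $1\le c\le C$; $q_C(x,y)=0$ otherwise ($e_i$ is the $i$-th unit vector). For $x\in\mathcal X_C$, $a(x)=\sum_{i=1}^N\mathbf 1_{\{x_i\ne0\}}$; $\mathcal A(C)=\max_{x\in\mathcal X_C}a(x)$; the set of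 dominant states is $\mathcal D_C=\{x\in\mathcal X_C:a(x)=\mathcal A(C)\}$; for $i\in V$, $\mathcal S_C(i)=\{s\in\mathcal D_C:s_i\ne0\}$ is the set of dominant states in which node $i$ is active. $\tau_{x,A}(\nu)=\inf\{t>0:X_C(t)\in A\}$ is the first hitting time of $A\subset\mathcal X_C$ for the process started at $X_C(0)=x$. A path $\omega:x\to y$ is a finite sequence $\omega_1,\dots,\omega_n\in\mathcal X_C$ with $\omega_1=x$, $\omega_n=y$ and $q_C(\omega_k,\omega_{k+1})>0$ for $k=1,\dots,n-1$. The communication height is $$\Delta(x,y)=\min_{\omega:x\to y}\ \max_{z\in\omega}\,(\mathcal A(C)-a(z)).$$ $\log_\nu$ denotes logarithm in base $\nu$. *)

theory Defs
  imports "HOL-Probability.Probability"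
begin

definition simple_graph :: "'v set \<Rightarrow> ('v \<times> 'v) set \<Rightarrow> bool" where
  "simple_graph V E \<longleftrightarrow> E \<subseteq> V \<times> V \<and> sym E \<and> irrefl E"

definition states :: "nat \<Rightarrow> nat \<Rightarrow> (nat \<Rightarrow> (nat \<times> nat) set) \<Rightarrow> (nat \<Rightarrow> nat) set" where
  "states N C E =
     {x \<in> {1..N} \<rightarrow>\<^sub>E {0..C}. \<forall>c\<in>{1..C}. \<forall>(i, j)\<in>E c. \<not> (x i = c \<and> x j = c)}"

definition rate :: "nat \<Rightarrow> nat \<Rightarrow> real \<Rightarrow> (nat \<Rightarrow> nat) \<Rightarrow> (nat \<Rightarrow> nat) \<Rightarrow> real" where
  "rate N C \<nu> x y =
     (if \<exists>i\<in>{1..N}. \<exists>c\<in>{1..C}. x i = 0 \<and> y = x(i := c) then \<nu>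
      else if \<exists>i\<in>{1..N}. \<exists>c\<in>{1..C}. x i = c \<and> y = x(i := 0) then 1
      else 0)"

definition activity :: "nat \<Rightarrow> (nat \<Rightarrow> nat) \<Rightarrow> nat" where
  "activity N x = card {i \<in> {1..N}. x i \<noteq> 0}"

definition max_activity :: "nat \<Rightarrow> nat \<Rightarrow> (nat \<Rightarrow> (nat \<times> nat) set) \<Rightarrow> nat" where
  "max_activity N C E = Max (activity N ` states N C E)"

definition dominant :: "nat \<Rightarrow> nat \<Rightarrow> (nat \<Rightarrow> (nat \<times> nat) set) \<Rightarrow> (nat \<Rightarrow> nat) set" where
  "dominant N C E = {x \<in> states N C E. activity N x = max_activity N C E}"

definition dominant_active ::
  "nat \<Rightarrow> nat \<Rightarrow> (nat \<Rightarrow> (nat \<times> nat) set) \<Rightarrow> nat \<Rightarrow> (nat \<Rightarrow> nat) set" where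
  "dominant_active N C E i = {s \<in> dominant N C E. s i \<noteq> 0}"

text \<open>Paths, and hence communication heights, do not depend on the activation rate: see
  \<open>rate_pos_indep\<close> below.\<close>

definition is_path ::
  "nat \<Rightarrow> nat \<Rightarrow> (nat \<Rightarrow> (nat \<times> nat) set) \<Rightarrow> (nat \<Rightarrow> nat) list \<Rightarrow> (nat \<Rightarrow> nat) \<Rightarrow> (nat \<Rightarrow> nat) \<Rightarrow> bool"
  where
  "is_path N C E \<omega> x y \<longleftrightarrow>
     \<omega> \<noteq> [] \<and> set \<omega> \<subseteq> states N C E \<and> hd \<omega> = x \<and> last \<omega> = y \<and>
     (\<forall>k. Suc k < length \<omega> \<longrightarrow> (\<forall>\<nu>>1. rate N C \<nu> (\<omega> ! k) (\<omega> ! Suc k) > 0))"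

lemma rate_pos_indep:
  assumes "\<nu> > 1" "\<nu>' > 1"
  shows "rate N C \<nu> x y > 0 \<longleftrightarrow> rate N C \<nu>' x y > 0"
  unfolding rate_def using assms by (auto split: if_split)

definition comm_height ::
  "nat \<Rightarrow> nat \<Rightarrow> (nat \<Rightarrow> (nat \<times> nat) set) \<Rightarrow> (nat \<Rightarrow> nat) \<Rightarrow> (nat \<Rightarrow> nat) \<Rightarrow> int" where
  "comm_height N C E x y =
     Min {Max ((\<lambda>z. int (max_activity N C E) - int (activity N z)) ` set \<omega>) | \<omega>. is_path N C E \<omega> x y}"

definition starvation_index :: "nat \<Rightarrow> nat \<Rightarrow> (nat \<Rightarrow> (nat \<times> nat) set) \<Rightarrow> nat \<Rightarrow> int" where
  "starvation_index N C E i =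
     Max ((\<lambda>s. Min (comm_height N C E s ` dominant_active N C E i)) `
       (dominant N C E - dominant_active N C E i))"

definition transition_function :: "'s set \<Rightarrow> (real \<Rightarrow> 's \<Rightarrow> 's \<Rightarrow> real) \<Rightarrow> bool" where
  "transition_function S p \<longleftrightarrow>
     (\<forall>t\<ge>0. \<forall>x\<in>S. (\<forall>y\<in>S. p t x y \<ge> 0) \<and> (\<Sum>y\<in>S. p t x y) = 1) \<and>
     (\<forall>x\<in>S. \<forall>y\<in>S. p 0 x y = of_bool (x = y)) \<and>
     (\<forall>s\<ge>0. \<forall>t\<ge>0. \<forall>x\<in>S. \<forall>y\<in>S. p (s + t) x y = (\<Sum>z\<in>S. p s x z * p t z y))"

text \<open>A time-homogeneous continuous-time Markov process on the finite set \<open>S\<close>, started at \<open>x\<^sub>0\<close>,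
  whose transition function \<open>p\<close> has off-diagonal derivatives \<open>q\<close> at \<open>0\<close> (the diagonal ones are then
  forced, since the rows of \<open>p\<close> sum to \<open>1\<close>). Paths are right-continuous for the discrete topology
  on \<open>S\<close>.\<close>

definition markov_process ::
  "'s set \<Rightarrow> ('s \<Rightarrow> 's \<Rightarrow> real) \<Rightarrow> 's \<Rightarrow> 'w measure \<Rightarrow> (real \<Rightarrow> 'w \<Rightarrow> 's) \<Rightarrow> bool" where
  "markov_process S q x\<^sub>0 M X \<longleftrightarrow>
     prob_space M \<and>
     (\<forall>t\<ge>0. X t \<in> M \<rightarrow>\<^sub>M count_space S) \<and>
     (AE \<omega> in M. X 0 \<omega> = x\<^sub>0) \<and>
     (\<forall>\<omega>\<in>space M. \<forall>t\<ge>0. \<forall>\<^sub>F u in at_right t. X u \<omega> = X t \<omega>) \<and>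
     (\<exists>p. transition_function S p \<and>
        (\<forall>x\<in>S. \<forall>y\<in>S. x \<noteq> y \<longrightarrow> ((\<lambda>h. p h x y / h) \<longlongrightarrow> q x y) (at_right 0)) \<and>
        (\<forall>n t z. t 0 \<ge> 0 \<longrightarrow> (\<forall>k\<le>n. t k < t (Suc k)) \<longrightarrow> (\<forall>k\<le>Suc n. z k \<in> S) \<longrightarrow>
           measure M {\<omega> \<in> space M. \<forall>k\<le>Suc n. X (t k) \<omega> = z k} =
           measure M {\<omega> \<in> space M. \<forall>k\<le>n. X (t k) \<omega> = z k} * p (t (Suc n) - t n) (z n) (z (Suc n))))"

definition hitting_time :: "(real \<Rightarrow> 'w \<Rightarrow> 's) \<Rightarrow> 's set \<Rightarrow> 'w \<Rightarrow> ennreal" where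
  "hitting_time X A \<omega> = (INF t\<in>{t. t > 0 \<and> X t \<omega> \<in> A}. ennreal t)"

definition expected_hitting_time :: "'w measure \<Rightarrow> (real \<Rightarrow> 'w \<Rightarrow> 's) \<Rightarrow> 's set \<Rightarrow> ennreal" where
  "expected_hitting_time M X A = (\<integral>\<^sup>+\<omega>. hitting_time X A \<omega> \<partial>M)"

text \<open>An extended-valued logarithm, so that an infinite expectation is not mapped to a junk value.\<close>

definition elog :: "real \<Rightarrow> ennreal \<Rightarrow> ereal" where
  "elog b x = (if x = 0 then -\<infinity> else if x = \<infinity> then \<infinity> else ereal (log b (enn2real x)))"

end

(*  The chain is reversible with weights pi(x) = nu^a(x), and the edge between neighbours x, y has
    conductance nu^max(a(x), a(y)). For s in D the expected hitting time f(s) of S_i solves a Poisson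
    equation, so f(s) = sum_x pi(x) u(x), where u is the Green function of s killed on S_i; as u is
    maximal at s, pi(s) u(s) <= f(s) <= pi(X) u(s). Here u(s) is an effective resistance: along a path
    of optimal height Gamma every conductance is at least nu^(A(C) - Gamma + 1), and every edge leaving
    the set of states reachable from s below height Gamma has at most that conductance. Hence f(s) is
    of exact order nu^(Gamma - 1), with constants independent of nu.

    The Markov process enters only through its finite-dimensional distributions: the hitting time is
    the decreasing limit of the hitting times of dyadic skeleton chains, whose expectations are
    squeezed by applying the transition matrix of a small time step h to f, since
    p_h f = f - h + o(h) off S_i.
*)

theory Submission
  imports Defs
begin

section \<open>Expected hitting times\<close>

locale discrete_chain = prob_space M for M :: "'w measure" +
  fixes S :: "'s set" and P :: "'s \<Rightarrow> 's \<Rightarrow> real" and Y :: "nat \<Rightarrow> 'w \<Rightarrow> 's"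
    and x\<^sub>0 :: 's and B :: "'s set"
  assumes finite_S: "finite S"
    and Y_measurable [measurable]: "\<And>k. Y k \<in> M \<rightarrow>\<^sub>M count_space S"
    and Y_0: "AE \<omega> in M. Y 0 \<omega> = x\<^sub>0"
    and B_subset: "B \<subseteq> S"
    and x\<^sub>0_in_B: "x\<^sub>0 \<in> B"
    and markov: "\<And>n z. (\<And>k. k \<le> Suc n \<Longrightarrow> z k \<in> S) \<Longrightarrow>
      prob {\<omega> \<in> space M. \<forall>k\<le>Suc n. Y k \<omega> = z k} =
      prob {\<omega> \<in> space M. \<forall>k\<le>n. Y k \<omega> = z k} * P (z n) (z (Suc n))"
begin

definition surviving :: "nat \<Rightarrow> 'w set" where
  "surviving n = {\<omega> \<in> space M. \<forall>k\<le>n. Y k \<omega> \<in> B}"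

text \<open>The expectation of \<open>g (Y n)\<close> on \<open>surviving n\<close>, as a finite sum over trajectories so that
  the finite-dimensional distributions apply directly.\<close>

definition killed :: "nat \<Rightarrow> ('s \<Rightarrow> real) \<Rightarrow> real" where
  "killed n g = (\<Sum>z\<in>PiE {..n} (\<lambda>_. B). prob {\<omega> \<in> space M. \<forall>k\<le>n. Y k \<omega> = z k} * g (z n))"

lemma finite_B: "finite B"
  by (rule finite_subset[OF B_subset finite_S])

lemma cylinder_sets:
  assumes "\<And>k. k \<le> n \<Longrightarrow> z k \<in> S"
  shows "{\<omega> \<in> space M. \<forall>k\<le>n. Y k \<omega> = z k} \<in> sets M"
proof -
  have "{\<omega> \<in> space M. \<forall>k\<in>{..n}. Y k \<omega> = z k} \<in> sets M"
  proof (rule sets.sets_Collect_finite_All)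
    fix k assume "k \<in> {..n}"
    then show "{\<omega> \<in> space M. Y k \<omega> = z k} \<in> sets M"
      using measurable_sets[OF Y_measurable[of k], of "{z k}"] assms
      by (simp add: vimage_def Int_def conj_commute)
  qed simp
  then show ?thesis unfolding Ball_def atMost_iff .
qed

lemma surviving_sets [measurable]: "surviving n \<in> sets M"
proof -
  have "{\<omega> \<in> space M. \<forall>k\<in>{..n}. Y k \<omega> \<in> B} \<in> sets M"
  proof (rule sets.sets_Collect_finite_All)
    fix k
    show "{\<omega> \<in> space M. Y k \<omega> \<in> B} \<in> sets M"
      using measurable_sets[OF Y_measurable[of k], of B] B_subset
      by (simp add: vimage_def Int_def conj_commute)
  qed simp
  then show ?thesis unfolding Ball_def atMost_iff surviving_def .
qed

lemma killed_mono:
  assumes "\<And>x. x \<in> B \<Longrightarrow> g x \<le> g' x"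
  shows "killed n g \<le> killed n g'"
  unfolding killed_def by (intro sum_mono mult_left_mono assms) (auto simp: PiE_iff)

lemma killed_diff_const: "killed n (\<lambda>x. g x - a) = killed n g - a * killed n (\<lambda>_. 1)"
  unfolding killed_def sum_distrib_left sum_subtractf[symmetric]
  by (intro sum.cong) (simp_all add: algebra_simps)

lemma killed_cmult: "killed n (\<lambda>x. a * g x) = a * killed n g"
  unfolding killed_def sum_distrib_left by (intro sum.cong) simp_all

lemma killed_nonneg:
  assumes "\<And>x. x \<in> B \<Longrightarrow> 0 \<le> g x"
  shows "0 \<le> killed n g"
  unfolding killed_def by (intro sum_nonneg mult_nonneg_nonneg assms) (auto simp: PiE_iff)

text \<open>The cylinders of the trajectories in \<open>B\<close> partition
  \<open>surviving n\<close>.\<close>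

lemma killed_1: "killed n (\<lambda>_. 1) = prob (surviving n)"
proof -
  have "surviving n = (\<Union>z\<in>PiE {..n} (\<lambda>_. B). {\<omega> \<in> space M. \<forall>k\<le>n. Y k \<omega> = z k})"
  proof (intro set_eqI iffI)
    fix \<omega> assume "\<omega> \<in> surviving n"
    then show "\<omega> \<in> (\<Union>z\<in>PiE {..n} (\<lambda>_. B). {\<omega> \<in> space M. \<forall>k\<le>n. Y k \<omega> = z k})"
      by (intro UN_I[of "restrict (\<lambda>k. Y k \<omega>) {..n}"]) (auto simp: surviving_def)
  qed (auto simp: surviving_def PiE_def Pi_def)
  moreover have "prob (\<Union>z\<in>PiE {..n} (\<lambda>_. B). {\<omega> \<in> space M. \<forall>k\<le>n. Y k \<omega> = z k}) =
     (\<Sum>z\<in>PiE {..n} (\<lambda>_. B). prob {\<omega> \<in> space M. \<forall>k\<le>n. Y k \<omega> = z k})"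
  proof (rule finite_measure_finite_Union)
    show "finite (PiE {..n} (\<lambda>_. B))" using finite_B by (simp add: finite_PiE)
    show "(\<lambda>z. {\<omega> \<in> space M. \<forall>k\<le>n. Y k \<omega> = z k}) ` PiE {..n} (\<lambda>_. B) \<subseteq> sets M"
      using B_subset by (auto intro!: cylinder_sets)
    show "disjoint_family_on (\<lambda>z. {\<omega> \<in> space M. \<forall>k\<le>n. Y k \<omega> = z k}) (PiE {..n} (\<lambda>_. B))"
    proof (unfold disjoint_family_on_def, intro ballI impI)
      fix z z' assume z: "z \<in> PiE {..n} (\<lambda>_. B)" "z' \<in> PiE {..n} (\<lambda>_. B)" "z \<noteq> z'"
      then obtain k where "k \<le> n" "z k \<noteq> z' k" by (metis PiE_ext atMost_iff)
      then show "{\<omega> \<in> space M. \<forall>k\<le>n. Y k \<omega> = z k} \<inter> {\<omega> \<in> space M. \<forall>k\<le>n. Y k \<omega> = z' k} = {}"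
        by force
    qed
  qed
  ultimately show ?thesis by (simp add: killed_def)
qed

lemma killed_0: "killed 0 g = g x\<^sub>0"
proof -
  have *: "prob {\<omega> \<in> space M. Y 0 \<omega> = y} = of_bool (y = x\<^sub>0)" if "y \<in> B" for y
  proof -
    have [measurable]: "{\<omega> \<in> space M. Y 0 \<omega> = y} \<in> sets M"
      using cylinder_sets[of 0 "\<lambda>_. y"] that B_subset by auto
    have "prob {\<omega> \<in> space M. Y 0 \<omega> = y} = prob {\<omega> \<in> space M. y = x\<^sub>0}"
      using Y_0 by (intro finite_measure_eq_AE) auto
    then show ?thesis by (cases "y = x\<^sub>0") (auto simp: prob_space)
  qed
  have "killed 0 g = (\<Sum>z\<in>PiE {0::nat} (\<lambda>_. B). prob {\<omega> \<in> space M. Y 0 \<omega> = z 0} * g (z 0))"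
    by (simp add: killed_def)
  also have "\<dots> = (\<Sum>y\<in>B. prob {\<omega> \<in> space M. Y 0 \<omega> = y} * g y)"
    by (rule sum.reindex_bij_witness[of _ "\<lambda>y. restrict (\<lambda>_. y) {0}" "\<lambda>z. z 0"])
       (auto simp: PiE_def extensional_def restrict_def)
  also have "\<dots> = (\<Sum>y\<in>B. if x\<^sub>0 = y then g y else 0)"
    by (intro sum.cong) (auto simp: *)
  finally show ?thesis using x\<^sub>0_in_B finite_B by simp
qed

text \<open>Markov property at the last step: splitting off the final coordinate of a trajectory
  turns \<open>g\<close> into its one-step expectation, with mass leaving \<open>B\<close>
  discarded.\<close>

lemma killed_Suc: "killed (Suc n) g = killed n (\<lambda>x. \<Sum>y\<in>B. P x y * g y)"
proof -
  let ?F = "PiE {..n} (\<lambda>_. B)"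
  have inj: "inj_on (\<lambda>(y, w). w(Suc n := y)) (B \<times> ?F)"
    using inj_combinator[of "Suc n" "{..n}" "\<lambda>_. B"] by simp
  have "killed (Suc n) g = (\<Sum>z\<in>(\<lambda>(y, w). w(Suc n := y)) ` (B \<times> ?F).
      prob {\<omega> \<in> space M. \<forall>k\<le>Suc n. Y k \<omega> = z k} * g (z (Suc n)))"
    by (simp add: killed_def atMost_Suc PiE_insert_eq)
  also have "\<dots> = (\<Sum>(y, w)\<in>B \<times> ?F. prob {\<omega> \<in> space M. \<forall>k\<le>n. Y k \<omega> = w k} * (P (w n) y * g y))"
  proof (subst sum.reindex[OF inj], rule sum.cong[OF refl], clarify)
    fix y w assume y: "y \<in> B" and w: "w \<in> ?F"
    have "prob {\<omega> \<in> space M. \<forall>k\<le>Suc n. Y k \<omega> = (w(Suc n := y)) k} =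
        prob {\<omega> \<in> space M. \<forall>k\<le>n. Y k \<omega> = (w(Suc n := y)) k} * P ((w(Suc n := y)) n) ((w(Suc n := y)) (Suc n))"
      using y w B_subset by (intro markov) (auto simp: PiE_def Pi_def le_Suc_eq)
    moreover have "{\<omega> \<in> space M. \<forall>k\<le>n. Y k \<omega> = (w(Suc n := y)) k} = {\<omega> \<in> space M. \<forall>k\<le>n. Y k \<omega> = w k}"
      by auto
    ultimately show "((\<lambda>z. prob {\<omega> \<in> space M. \<forall>k\<le>Suc n. Y k \<omega> = z k} * g (z (Suc n))) \<circ>
          (\<lambda>(y, w). w(Suc n := y))) (y, w) =
        prob {\<omega> \<in> space M. \<forall>k\<le>n. Y k \<omega> = w k} * (P (w n) y * g y)"
      by simp
  qed
  also have "\<dots> = killed n (\<lambda>x. \<Sum>y\<in>B. P x y * g y)"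
    by (simp add: killed_def sum.cartesian_product[symmetric] sum_distrib_left, subst sum.swap) simp
  finally show ?thesis .
qed

text \<open>A drift argument. By \<open>killed_Suc\<close>, each step lowers
  \<open>killed n g\<close> by at least \<open>a\<close> and at most \<open>b\<close> times the
  survival probability; telescoping bounds the sum of survival probabilities, which is the expected
  exit step.\<close>

lemma survival_sum_bounds:
  assumes g: "\<And>x. x \<in> B \<Longrightarrow> 0 \<le> g x"
    and up: "\<And>x. x \<in> B \<Longrightarrow> (\<Sum>y\<in>B. P x y * g y) \<le> g x - a" and a: "a > 0"
    and low: "\<And>x. x \<in> B \<Longrightarrow> g x - b \<le> (\<Sum>y\<in>B. P x y * g y)"
  shows "summable (\<lambda>k. prob (surviving k))"
    and "a * (\<Sum>k. prob (surviving k)) \<le> g x\<^sub>0"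
    and "g x\<^sub>0 \<le> b * (\<Sum>k. prob (surviving k))"
proof -
  have 1: "a * (\<Sum>k<n. prob (surviving k)) + killed n g \<le> g x\<^sub>0" for n
  proof (induction n)
    case (Suc n)
    have "killed (Suc n) g \<le> killed n (\<lambda>x. g x - a)"
      unfolding killed_Suc by (intro killed_mono up)
    with Suc show ?case by (simp add: killed_diff_const killed_1 algebra_simps)
  qed (simp add: killed_0)
  have 2: "g x\<^sub>0 \<le> b * (\<Sum>k<n. prob (surviving k)) + killed n g" for n
  proof (induction n)
    case (Suc n)
    have "killed n (\<lambda>x. g x - b) \<le> killed (Suc n) g"
      unfolding killed_Suc by (intro killed_mono low)
    with Suc show ?case by (simp add: killed_diff_const killed_1 algebra_simps)
  qed (simp add: killed_0)
  have 3: "(\<Sum>k<n. prob (surviving k)) \<le> g x\<^sub>0 / a" for n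
    using 1[of n] killed_nonneg[of g n, OF g] a by (simp add: pos_le_divide_eq mult.commute)
  show s: "summable (\<lambda>k. prob (surviving k))"
    by (rule summableI_nonneg_bounded[OF _ 3]) simp
  have "(\<Sum>k. prob (surviving k)) \<le> g x\<^sub>0 / a"
    using suminf_le_const[OF s 3] .
  then show "a * (\<Sum>k. prob (surviving k)) \<le> g x\<^sub>0"
    using a by (simp add: pos_le_divide_eq mult.commute)
  \<comment> \<open>\<open>g\<close> is bounded on the finite \<open>B\<close>, so the remainder
    \<open>killed n g\<close> is at most \<open>K\<close> times the survival probability, which
    tends to 0 by summability.\<close>
  obtain K where K: "\<And>x. x \<in> B \<Longrightarrow> g x \<le> K"
    using finite_B by (metis Max_ge finite_imageI imageI)
  have "(\<lambda>n. b * (\<Sum>k<n. prob (surviving k)) + K * prob (surviving n)) \<longlonglongrightarrow> b * (\<Sum>k. prob (surviving k)) + K * 0"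
    by (intro tendsto_intros summable_LIMSEQ s summable_LIMSEQ_zero)
  moreover have "g x\<^sub>0 \<le> b * (\<Sum>k<n. prob (surviving k)) + K * prob (surviving n)" for n
  proof -
    have "killed n g \<le> killed n (\<lambda>x. K * 1)" by (intro killed_mono) (simp add: K)
    with 2[of n] show ?thesis by (simp only: killed_cmult killed_1)
  qed
  ultimately show "g x\<^sub>0 \<le> b * (\<Sum>k. prob (surviving k))"
    by (metis (no_types, lifting) LIMSEQ_le_const add.right_neutral mult_zero_right)
qed

text \<open>Along a path the sum of indicators is its first exit step from \<open>B\<close>, so the
  integral is the expected exit step.\<close>

lemma nn_integral_survival:
  assumes "summable (\<lambda>k. prob (surviving k))"
  shows "(\<integral>\<^sup>+\<omega>. (\<Sum>k. indicator (surviving k) \<omega>) \<partial>M) = ennreal (\<Sum>k. prob (surviving k))"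
proof -
  have "(\<integral>\<^sup>+\<omega>. (\<Sum>k. indicator (surviving k) \<omega>) \<partial>M) = (\<Sum>k. ennreal (prob (surviving k)))"
    by (subst nn_integral_suminf) (simp_all add: emeasure_eq_measure)
  also have "\<dots> = ennreal (\<Sum>k. prob (surviving k))"
    by (rule suminf_ennreal2) (simp_all add: assms)
  finally show ?thesis .
qed

end

section \<open>Hitting times as limits of exit times seen on a grid\<close>

lemma suminf_survival_le:
  assumes "\<not> Q m"
  shows "(\<Sum>k. of_bool (\<forall>j\<le>k. Q j) :: ennreal) \<le> of_nat m"
proof -
  have "(\<Sum>k. of_bool (\<forall>j\<le>k. Q j) :: ennreal) = (\<Sum>k<m. of_bool (\<forall>j\<le>k. Q j))"
    using assms by (intro suminf_finite) (auto simp: not_less)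
  also have "\<dots> \<le> (\<Sum>k<m. 1)" by (intro sum_mono) auto
  finally show ?thesis by simp
qed

text \<open>The series counts the initial run of indices satisfying \<open>Q\<close>: its value is
  the first failing index, or infinity if there is none.\<close>

lemma suminf_survival_cases:
  obtains "(\<Sum>k. of_bool (\<forall>j\<le>k. Q j) :: ennreal) = \<infinity>"
  | m where "\<not> Q m" "(\<Sum>k. of_bool (\<forall>j\<le>k. Q j) :: ennreal) = of_nat m"
proof (cases "\<exists>m. \<not> Q m")
  case True
  define m where "m = (LEAST m. \<not> Q m)"
  have m: "\<not> Q m" "\<And>j. j < m \<Longrightarrow> Q j"
    unfolding m_def using LeastI_ex[OF True] not_less_Least by blast+
  have "(\<Sum>k. of_bool (\<forall>j\<le>k. Q j) :: ennreal) = (\<Sum>k<m. of_bool (\<forall>j\<le>k. Q j))"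
    using m by (intro suminf_finite) (auto simp: not_less)
  also have "\<dots> = (\<Sum>k<m. 1)" using m(2) by (intro sum.cong) auto
  finally show ?thesis using m that by simp
next
  case False
  then have "(\<Sum>k. of_bool (\<forall>j\<le>k. Q j) :: ennreal) = (\<Sum>k. 1)" by simp
  also have "\<dots> = \<infinity>"
    by (simp add: suminf_eq_SUP ennreal_SUP_of_nat_eq_top)
  finally show ?thesis using that by blast
qed

text \<open>The first exit time from \<open>B\<close> seen on the grid of mesh \<open>h\<close>. As
  a series of indicators it is easily measured and integrated term by term.\<close>

definition skeleton_time :: "(real \<Rightarrow> 'w \<Rightarrow> 's) \<Rightarrow> 's set \<Rightarrow> real \<Rightarrow> 'w \<Rightarrow> ennreal" where
  "skeleton_time X B h \<omega> = ennreal h * (\<Sum>k. of_bool (\<forall>j\<le>k. X (real j * h) \<omega> \<in> B))"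

lemma skeleton_time_le:
  assumes "X (real m * h) \<omega> \<notin> B" "h > 0"
  shows "skeleton_time X B h \<omega> \<le> ennreal (real m * h)"
proof -
  have "skeleton_time X B h \<omega> \<le> ennreal h * of_nat m"
    unfolding skeleton_time_def
    using assms(1) by (intro mult_left_mono suminf_survival_le) auto
  also have "\<dots> = ennreal (real m * h)"
    using assms(2) by (simp add: ennreal_mult' ennreal_of_nat_eq_real_of_nat mult.commute)
  finally show ?thesis .
qed

lemma skeleton_time_cases:
  assumes "h > 0"
  obtains "skeleton_time X B h \<omega> = \<infinity>"
  | m where "X (real m * h) \<omega> \<notin> B" "skeleton_time X B h \<omega> = ennreal (real m * h)"
proof (cases rule: suminf_survival_cases[of "\<lambda>j. X (real j * h) \<omega> \<in> B"])
  case 1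
  then show ?thesis using assms that(1) by (simp add: skeleton_time_def ennreal_mult_top)
next
  case (2 m)
  then show ?thesis using assms that(2)[of m]
    by (simp add: skeleton_time_def ennreal_mult' ennreal_of_nat_eq_real_of_nat mult.commute)
qed

text \<open>Halving the mesh keeps all old grid points, so an exit cannot be seen later.\<close>

lemma skeleton_time_half:
  assumes "h > 0"
  shows "skeleton_time X B (h / 2) \<omega> \<le> skeleton_time X B h \<omega>"
proof (cases rule: skeleton_time_cases[OF assms, of X B \<omega>])
  case (2 m)
  have "skeleton_time X B (h / 2) \<omega> \<le> ennreal (real (2 * m) * (h / 2))"
    using 2 assms by (intro skeleton_time_le) auto
  then show ?thesis using 2 by simp
qed simp

text \<open>Every grid hit is a hit, which gives one inequality. Conversely, right-continuity keeps
  the path in \<open>A\<close> for some time after a hit, and a fine enough grid has a point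
  there.\<close>

lemma hitting_time_eq_INF_skeleton:
  assumes S: "\<And>t. t \<ge> 0 \<Longrightarrow> X t \<omega> \<in> S" and A: "A \<subseteq> S" and X0: "X 0 \<omega> \<in> S - A"
    and rc: "\<And>t. t \<ge> 0 \<Longrightarrow> \<forall>\<^sub>F u in at_right t. X u \<omega> = X t \<omega>"
    and h: "\<And>n. h n > 0" "h \<longlonglongrightarrow> 0"
  shows "hitting_time X A \<omega> = (INF n. skeleton_time X (S - A) (h n) \<omega>)"
proof (rule antisym)
  show "hitting_time X A \<omega> \<le> (INF n. skeleton_time X (S - A) (h n) \<omega>)"
  proof (rule INF_greatest)
    fix n
    show "hitting_time X A \<omega> \<le> skeleton_time X (S - A) (h n) \<omega>"
    proof (cases rule: skeleton_time_cases[OF h(1)[of n], of X "S - A" \<omega>])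
      case (2 m)
      \<comment> \<open>Grid time 0 must be excluded because \<open>hitting_time\<close> only admits
        \<open>t > 0\<close>; the start lies outside \<open>A\<close>.\<close>
      with X0 have "m \<noteq> 0" by (cases m) auto
      moreover have "X (real m * h n) \<omega> \<in> A"
        using 2(1) S[of "real m * h n"] h(1)[of n] by auto
      ultimately show ?thesis
        unfolding hitting_time_def 2(2) using h(1)[of n] by (intro INF_lower) simp
    qed simp
  qed
  show "(INF n. skeleton_time X (S - A) (h n) \<omega>) \<le> hitting_time X A \<omega>"
    unfolding hitting_time_def
  proof (rule INF_greatest, rule ennreal_le_epsilon)
    fix t e :: real
    assume "t \<in> {t. t > 0 \<and> X t \<omega> \<in> A}" and e: "e > 0"
    then have t: "t > 0" "X t \<omega> \<in> A" by auto
    obtain b where b: "b > t" "\<And>u. t < u \<Longrightarrow> u < b \<Longrightarrow> X u \<omega> = X t \<omega>"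
      using rc[of t] t by (auto simp: eventually_at_right_field)
    have "\<forall>\<^sub>F n in sequentially. h n < min e (b - t)"
      using e b by (intro order_tendstoD(2)[OF h(2)]) auto
    then obtain n where n: "h n < e" "h n < b - t"
      by (auto simp: eventually_sequentially)
    \<comment> \<open>Index of the first grid point strictly after \<open>t\<close>; it lies in
      \<open>(t, t + h n]\<close>, hence before \<open>b\<close> and within \<open>e\<close> of
      \<open>t\<close>.\<close>
    define m where "m = nat (\<lfloor>t / h n\<rfloor> + 1)"
    have "t / h n > 0" using t h(1) by simp
    then have m: "real m = of_int \<lfloor>t / h n\<rfloor> + 1" by (simp add: m_def)
    have "t / h n < real m" "real m \<le> t / h n + 1" unfolding m by linarith+
    then have mh: "t < real m * h n" "real m * h n \<le> t + h n"
      using h(1)[of n] by (auto simp: field_simps)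
    then have "X (real m * h n) \<omega> \<notin> S - A" using b(2)[of "real m * h n"] n t by auto
    then have "skeleton_time X (S - A) (h n) \<omega> \<le> ennreal (real m * h n)"
      using h(1) by (rule skeleton_time_le)
    also have "\<dots> \<le> ennreal (t + e)" using mh n by (intro ennreal_leI) linarith
    finally show "(INF n. skeleton_time X (S - A) (h n) \<omega>) \<le> ennreal t + ennreal e"
      using t e by (metis INF_lower2 UNIV_I ennreal_plus less_imp_le)
  qed
qed

text \<open>Any nonnegative solution of Poisson's equation with zero values on \<open>A\<close>
  gives the expectation, finiteness included. For mesh \<open>h\<close>, one step lowers
  \<open>f\<close> by \<open>h + o(h)\<close>, so \<open>survival_sum_bounds\<close> places the
  expected skeleton time near \<open>f x\<^sub>0\<close>; monotone convergence then yields the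
  hitting time.\<close>

lemma expected_hitting_time_eq:
  fixes f :: "'s \<Rightarrow> real"
  assumes S: "finite S" and mp: "markov_process S q x\<^sub>0 M X" and A: "A \<subseteq> S" and x0: "x\<^sub>0 \<in> S - A"
    and f_nonneg: "\<And>x. x \<in> S - A \<Longrightarrow> 0 \<le> f x" and f_zero: "\<And>x. x \<in> A \<Longrightarrow> f x = 0"
    and gen: "\<And>x. x \<in> S - A \<Longrightarrow> (\<Sum>y\<in>S. q x y * (f y - f x)) = - 1"
  shows "expected_hitting_time M X A = ennreal (f x\<^sub>0)"
proof -
  note mp = mp[unfolded markov_process_def]
  note X_process = mp[THEN conjunct2]
  have X_meas [measurable]: "X t \<in> M \<rightarrow>\<^sub>M count_space S" if "t \<ge> 0" for t
    using X_process[THEN conjunct1] that by simp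
  note X_0 = X_process[THEN conjunct2, THEN conjunct1]
  have rc: "\<forall>\<^sub>F u in at_right t. X u \<omega> = X t \<omega>" if "\<omega> \<in> space M" "t \<ge> 0" for \<omega> t
    using X_process[THEN conjunct2, THEN conjunct2, THEN conjunct1, rule_format, OF that] .
  obtain p where p_conj: "transition_function S p \<and>
        (\<forall>x\<in>S. \<forall>y\<in>S. x \<noteq> y \<longrightarrow> ((\<lambda>h. p h x y / h) \<longlongrightarrow> q x y) (at_right 0)) \<and>
        (\<forall>n t z. t 0 \<ge> 0 \<longrightarrow> (\<forall>k\<le>n. t k < t (Suc k)) \<longrightarrow> (\<forall>k\<le>Suc n. z k \<in> S) \<longrightarrow>
           measure M {\<omega> \<in> space M. \<forall>k\<le>Suc n. X (t k) \<omega> = z k} =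
           measure M {\<omega> \<in> space M. \<forall>k\<le>n. X (t k) \<omega> = z k} * p (t (Suc n) - t n) (z n) (z (Suc n)))"
    using X_process[THEN conjunct2, THEN conjunct2, THEN conjunct2] by (rule exE)
  note p = p_conj[THEN conjunct1]
    and pq = p_conj[THEN conjunct2, THEN conjunct1, rule_format]
    and fdd = p_conj[THEN conjunct2, THEN conjunct2, rule_format]
  interpret prob_space M using mp by (rule conjunct1)
  define B where "B = S - A"
  have x0B: "x\<^sub>0 \<in> B" and BS: "B \<subseteq> S" and finB: "finite B"
    using x0 S by (auto simp: B_def)
  have chain: "discrete_chain M S (p h) (\<lambda>k. X (real k * h)) x\<^sub>0 B" if h: "h > 0" for h
  proof (unfold_locales)
    show "X (real k * h) \<in> M \<rightarrow>\<^sub>M count_space S" for k using h by (intro X_meas) simp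
    fix n :: nat and z :: "nat \<Rightarrow> 's" assume "\<And>k. k \<le> Suc n \<Longrightarrow> z k \<in> S"
    then show "prob {\<omega> \<in> space M. \<forall>k\<le>Suc n. X (real k * h) \<omega> = z k} =
      prob {\<omega> \<in> space M. \<forall>k\<le>n. X (real k * h) \<omega> = z k} * p h (z n) (z (Suc n))"
      using fdd[of "\<lambda>k. real k * h" n z] h by (simp add: algebra_simps)
  qed (use S X_0 x0B BS in simp_all)
  define sv where "sv h k = {\<omega> \<in> space M. \<forall>j\<le>k. X (real j * h) \<omega> \<in> B}" for h and k :: nat
  have gen_lim: "((\<lambda>h. (\<Sum>y\<in>S. p h x y * (f y - f x)) / h) \<longlongrightarrow> - 1) (at_right 0)" if x: "x \<in> B" for x
  proof -
    have "((\<lambda>h. \<Sum>y\<in>S. p h x y / h * (f y - f x)) \<longlongrightarrow> (\<Sum>y\<in>S. q x y * (f y - f x))) (at_right 0)"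
    proof (rule tendsto_sum)
      \<comment> \<open>On the diagonal no derivative of \<open>p\<close> is at hand, but there the
        factor \<open>f y - f x\<close> vanishes.\<close>
      fix y assume "y \<in> S"
      then show "((\<lambda>h. p h x y / h * (f y - f x)) \<longlongrightarrow> q x y * (f y - f x)) (at_right 0)"
        using x BS by (cases "x = y") (simp, intro tendsto_mult tendsto_const pq, auto)
    qed
    then show ?thesis using x gen by (simp add: B_def sum_divide_distrib)
  qed
  have bounds: "\<exists>\<delta>>0. \<forall>h. 0 < h \<longrightarrow> h < \<delta> \<longrightarrow> summable (\<lambda>k. prob (sv h k)) \<and>
      (1 - e) * (h * (\<Sum>k. prob (sv h k))) \<le> f x\<^sub>0 \<and> f x\<^sub>0 \<le> (1 + e) * (h * (\<Sum>k. prob (sv h k)))"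
    if e: "0 < e" "e < 1" for e :: real
  proof -
    \<comment> \<open>As \<open>B\<close> is finite, the limits hold uniformly, so a single \<delta>
      serves all states.\<close>
    have "\<forall>\<^sub>F h in at_right 0. \<forall>x\<in>B. dist ((\<Sum>y\<in>S. p h x y * (f y - f x)) / h) (- 1) < e"
      using finB gen_lim e by (intro eventually_ball_finite ballI tendstoD) auto
    then obtain \<delta> where \<delta>: "\<delta> > 0"
      "\<And>h x. 0 < h \<Longrightarrow> h < \<delta> \<Longrightarrow> x \<in> B \<Longrightarrow> \<bar>(\<Sum>y\<in>S. p h x y * (f y - f x)) / h + 1\<bar> < e"
      by (auto simp: eventually_at_right_field dist_real_def)
    show ?thesis
    proof (intro exI[of _ \<delta>] conjI allI impI)
      fix h assume h: "0 < h" "h < \<delta>"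
      interpret dc: discrete_chain M S "p h" "\<lambda>k. X (real k * h)" x\<^sub>0 B
        using h by (intro chain)
      \<comment> \<open>\<open>f\<close> vanishes on \<open>A\<close>, so the sum over
        \<open>B\<close> extends to \<open>S\<close>; row sums equal to 1 then isolate the
        increment.\<close>
      have step: "(\<Sum>y\<in>B. p h x y * f y) = f x + (\<Sum>y\<in>S. p h x y * (f y - f x))" if x: "x \<in> B" for x
      proof -
        have "(\<Sum>y\<in>B. p h x y * f y) = (\<Sum>y\<in>S. p h x y * f y)"
          using S by (intro sum.mono_neutral_left) (auto simp: B_def f_zero)
        moreover have "(\<Sum>y\<in>S. p h x y) = 1"
          using p h x BS by (auto simp: transition_function_def)
        ultimately show ?thesis
          by (simp add: right_diff_distrib sum_subtractf flip: sum_distrib_right)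
      qed
      have near: "\<bar>(\<Sum>y\<in>S. p h x y * (f y - f x)) + h\<bar> \<le> e * h" if "x \<in> B" for x
      proof -
        have "\<bar>((\<Sum>y\<in>S. p h x y * (f y - f x)) / h + 1) * h\<bar> \<le> e * h"
          using \<delta>(2)[OF h that] h by (simp add: abs_mult)
        then show ?thesis using h by (simp add: algebra_simps)
      qed
      have up: "(\<Sum>y\<in>B. p h x y * f y) \<le> f x - (1 - e) * h"
        and low: "f x - (1 + e) * h \<le> (\<Sum>y\<in>B. p h x y * f y)" if "x \<in> B" for x
        using near[OF that] unfolding step[OF that] by (simp_all add: algebra_simps abs_le_iff)
      have sv: "sv h = dc.surviving"
        by (auto simp: sv_def dc.surviving_def fun_eq_iff)
      have pos: "(1 - e) * h > 0" using e h by simp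
      have nn: "\<And>x. x \<in> B \<Longrightarrow> 0 \<le> f x" using f_nonneg by (simp add: B_def)
      note bnds = dc.survival_sum_bounds[of f "(1 - e) * h" "(1 + e) * h", OF nn up pos low]
      show "summable (\<lambda>k. prob (sv h k))"
        "(1 - e) * (h * (\<Sum>k. prob (sv h k))) \<le> f x\<^sub>0"
        "f x\<^sub>0 \<le> (1 + e) * (h * (\<Sum>k. prob (sv h k)))"
        using bnds unfolding sv by (simp_all add: mult.assoc)
    qed (use \<delta> in auto)
  qed
  have sv_sets: "sv h k \<in> sets M" if "h > 0" for h k
  proof -
    interpret dc: discrete_chain M S "p h" "\<lambda>k. X (real k * h)" x\<^sub>0 B
      using that by (intro chain)
    show ?thesis using dc.surviving_sets[of k] unfolding dc.surviving_def sv_def .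
  qed
  have sum_meas: "(\<lambda>\<omega>. \<Sum>k. indicator (sv h k) \<omega> :: ennreal) \<in> borel_measurable M" if "h > 0" for h
    using sv_sets[OF that] by (intro borel_measurable_suminf_order borel_measurable_indicator)
  have skel: "skeleton_time X B h \<omega> = ennreal h * (\<Sum>k. indicator (sv h k) \<omega>)"
    if "\<omega> \<in> space M" for h \<omega>
    using that by (simp add: skeleton_time_def sv_def indicator_def of_bool_def)
  have skel_meas: "skeleton_time X B h \<in> borel_measurable M" if h: "h > 0" for h
  proof -
    have "(\<lambda>\<omega>. ennreal h * (\<Sum>k. indicator (sv h k) \<omega>)) \<in> borel_measurable M"
      using sum_meas[OF h] by measurable
    then show ?thesis by (subst measurable_cong[OF skel])
  qed
  have skel_int: "(\<integral>\<^sup>+\<omega>. skeleton_time X B h \<omega> \<partial>M) = ennreal (h * (\<Sum>k. prob (sv h k)))"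
    if h: "h > 0" and s: "summable (\<lambda>k. prob (sv h k))" for h
  proof -
    interpret dc: discrete_chain M S "p h" "\<lambda>k. X (real k * h)" x\<^sub>0 B
      using h by (intro chain)
    have sv: "sv h = dc.surviving"
      by (auto simp: sv_def dc.surviving_def fun_eq_iff)
    have "(\<integral>\<^sup>+\<omega>. skeleton_time X B h \<omega> \<partial>M) = (\<integral>\<^sup>+\<omega>. ennreal h * (\<Sum>k. indicator (sv h k) \<omega>) \<partial>M)"
      by (intro nn_integral_cong skel)
    also have "\<dots> = ennreal h * (\<integral>\<^sup>+\<omega>. (\<Sum>k. indicator (sv h k) \<omega>) \<partial>M)"
      by (intro nn_integral_cmult sum_meas h)
    also have "\<dots> = ennreal h * ennreal (\<Sum>k. prob (sv h k))"
      using dc.nn_integral_survival s unfolding sv by simp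
    finally show ?thesis using h by (simp add: ennreal_mult')
  qed
  \<comment> \<open>Any \<open>e\<close> in (0, 1) would do; the aim is summability for all small
    meshes.\<close>
  obtain \<delta> where \<delta>: "\<delta> > 0" "\<And>h. 0 < h \<Longrightarrow> h < \<delta> \<Longrightarrow> summable (\<lambda>k. prob (sv h k))"
    using bounds[of "1/2"] by auto
  \<comment> \<open>Dyadic meshes: all lie below \<delta>, and successive halving makes the skeleton
    times decrease.\<close>
  define h where "h n = \<delta> / 2 / 2 ^ n" for n :: nat
  have h_pos: "h n > 0" and h_less: "h n < \<delta>" and h_Suc: "h (Suc n) = h n / 2" for n
  proof -
    have "\<delta> / 2 / 2 ^ n \<le> \<delta> / 2" using \<delta>(1) by (simp add: divide_le_eq)
    then show "h n > 0" "h n < \<delta>" "h (Suc n) = h n / 2" using \<delta>(1) by (auto simp: h_def)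
  qed
  have h_lim: "h \<longlonglongrightarrow> 0"
    unfolding h_def
    by (rule LIMSEQ_divide_realpow_zero) simp
  have summ: "summable (\<lambda>k. prob (sv (h n) k))" for n
    using \<delta>(2)[OF h_pos h_less] .
  have dec: "decseq (\<lambda>n. skeleton_time X B (h n))"
    by (intro decseq_SucI le_funI) (simp only: h_Suc skeleton_time_half h_pos)
  have "AE \<omega> in M. hitting_time X A \<omega> = (INF n. skeleton_time X B (h n) \<omega>)"
    using X_0
  proof (rule AE_mp, intro AE_I2 impI)
    fix \<omega> assume \<omega>: "\<omega> \<in> space M" "X 0 \<omega> = x\<^sub>0"
    show "hitting_time X A \<omega> = (INF n. skeleton_time X B (h n) \<omega>)"
      unfolding B_def
    proof (rule hitting_time_eq_INF_skeleton)
      show "X t \<omega> \<in> S" if "t \<ge> 0" for t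
        using measurable_space[OF X_meas[OF that] \<omega>(1)] by simp
    qed (use \<omega> x0 A rc h_pos h_lim in auto)
  qed
  then have "expected_hitting_time M X A = (\<integral>\<^sup>+\<omega>. (INF n. skeleton_time X B (h n) \<omega>) \<partial>M)"
    unfolding expected_hitting_time_def by (rule nn_integral_cong_AE)
  \<comment> \<open>Monotone convergence from above needs a finite integral somewhere; index 0
    provides one.\<close>
  also have "(\<integral>\<^sup>+\<omega>. (INF n. skeleton_time X B (h n) \<omega>) \<partial>M) = (INF n. \<integral>\<^sup>+\<omega>. skeleton_time X B (h n) \<omega> \<partial>M)"
    by (rule nn_integral_monotone_convergence_INF_decseq[OF dec, of _ 0])
       (simp_all add: skel_meas h_pos skel_int summ)
  also have "\<dots> = ennreal (f x\<^sub>0)"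
  proof (rule LIMSEQ_unique)
    show "(\<lambda>n. \<integral>\<^sup>+\<omega>. skeleton_time X B (h n) \<omega> \<partial>M) \<longlonglongrightarrow> (INF n. \<integral>\<^sup>+\<omega>. skeleton_time X B (h n) \<omega> \<partial>M)"
      by (intro LIMSEQ_INF decseq_SucI nn_integral_mono) (rule decseq_SucD[OF dec, THEN le_funD])
    define a where "a n = h n * (\<Sum>k. prob (sv (h n) k))" for n
    have a_bounds: "\<forall>\<^sub>F n in sequentially. (1 - e) * a n \<le> f x\<^sub>0 \<and> f x\<^sub>0 \<le> (1 + e) * a n"
      if e: "0 < e" "e < 1" for e
    proof -
      obtain d where d: "d > 0" "\<And>h. 0 < h \<Longrightarrow> h < d \<Longrightarrow>
          (1 - e) * (h * (\<Sum>k. prob (sv h k))) \<le> f x\<^sub>0 \<and> f x\<^sub>0 \<le> (1 + e) * (h * (\<Sum>k. prob (sv h k)))"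
        using bounds[OF e] by auto
      have "\<forall>\<^sub>F n in sequentially. h n < d" using d(1) by (rule order_tendstoD(2)[OF h_lim])
      then show ?thesis
        by eventually_elim (use d(2) h_pos in \<open>simp add: a_def\<close>)
    qed
    have a_nonneg: "a n \<ge> 0" for n
      unfolding a_def using h_pos[of n] summ by (intro mult_nonneg_nonneg suminf_nonneg) auto
    have f0: "f x\<^sub>0 \<ge> 0" using f_nonneg x0 by simp
    have "a \<longlonglongrightarrow> f x\<^sub>0"
    proof (rule tendstoI)
      fix r :: real assume r: "r > 0"
      \<comment> \<open>Once \<open>e \<le> 1/2\<close>, the lower estimate gives
        \<open>a n \<le> 2 * f x\<^sub>0 \<le> K\<close>, so the error \<open>e * a n\<close> is at
        most \<open>e * K < r\<close>.\<close>
      define K where "K = 2 * f x\<^sub>0 + 1"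
      define e where "e = min (1/2) (r / (2 * K))"
      have K: "K > 0" using f0 by (simp add: K_def)
      have e: "0 < e" "e \<le> 1/2" "e * K < r"
      proof -
        show "0 < e" "e \<le> 1/2" using r K by (auto simp: e_def)
        have "e * K \<le> r / (2 * K) * K" using K by (intro mult_right_mono) (auto simp: e_def)
        also have "\<dots> < r" using K r by simp
        finally show "e * K < r" .
      qed
      have "\<forall>\<^sub>F n in sequentially. (1 - e) * a n \<le> f x\<^sub>0 \<and> f x\<^sub>0 \<le> (1 + e) * a n"
        using e by (intro a_bounds) auto
      then show "\<forall>\<^sub>F n in sequentially. dist (a n) (f x\<^sub>0) < r"
      proof eventually_elim
        case (elim n)
        have "(1/2) * a n \<le> (1 - e) * a n" using e a_nonneg by (intro mult_right_mono) auto
        then have "a n \<le> K" using elim by (simp add: K_def)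
        then have "e * a n \<le> e * K" using e by (intro mult_left_mono) auto
        then have "e * a n < r" using e by linarith
        then show ?case using elim by (auto simp: dist_real_def abs_less_iff algebra_simps)
      qed
    qed
    then have "(\<lambda>n. ennreal (a n)) \<longlonglongrightarrow> ennreal (f x\<^sub>0)" by (rule tendsto_ennrealI)
    then show "(\<lambda>n. \<integral>\<^sup>+\<omega>. skeleton_time X B (h n) \<omega> \<partial>M) \<longlonglongrightarrow> ennreal (f x\<^sub>0)"
      by (simp add: skel_int h_pos summ a_def)
  qed
  finally show ?thesis .
qed

section \<open>Green functions of finite networks\<close>

text \<open>Gaussian elimination, one index at a time. The pivot is positive as the value of the
  form at a unit vector, and the form of the Schur complement at \<open>v\<close> is the original
  form at the extension of \<open>v\<close> that annihilates row \<open>z\<close>.\<close>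

lemma positive_definite_solvable:
  fixes a :: "'s \<Rightarrow> 's \<Rightarrow> real"
  assumes "finite B"
    and "\<And>v. \<exists>x\<in>B. v x \<noteq> 0 \<Longrightarrow> (\<Sum>x\<in>B. v x * (\<Sum>y\<in>B. a x y * v y)) > 0"
  shows "\<exists>v. \<forall>x\<in>B. (\<Sum>y\<in>B. a x y * v y) = b x"
  using assms
proof (induction B arbitrary: a b rule: finite_induct)
  case (insert z B)
  define d where "d = a z z"
  have d: "d > 0"
  proof -
    have "(\<Sum>x\<in>insert z B. of_bool (x = z) * (\<Sum>y\<in>insert z B. a x y * of_bool (y = z))) > 0"
      by (rule insert.prems) auto
    moreover have "x = z \<longleftrightarrow> False" if "x \<in> B" for x using that insert.hyps by auto
    ultimately show ?thesis using insert.hyps by (simp add: d_def)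
  qed
  define a' where "a' x y = a x y - a x z * a z y / d" for x y
  define b' where "b' x = b x - a x z * b z / d" for x
  \<comment> \<open>The entry at \<open>z\<close> is chosen so that row \<open>z\<close> takes the
    value \<open>c\<close>: \<open>c = 0\<close> serves positivity, \<open>c = b z\<close> the final
    solution.\<close>
  define ext where "ext c v = v(z := (c - (\<Sum>y\<in>B. a z y * v y)) / d)" for c v
  \<comment> \<open>Eliminating the unknown at \<open>z\<close>: the Schur complement \<open>a'\<close> is again positive definite.\<close>
  have row_z: "(\<Sum>y\<in>insert z B. a z y * ext c v y) = c" for c v
  proof -
    have "(\<Sum>y\<in>B. a z y * ext c v y) = (\<Sum>y\<in>B. a z y * v y)"
      using insert.hyps by (intro sum.cong) (auto simp: ext_def)
    then show ?thesis using insert.hyps d by (simp add: ext_def d_def)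
  qed
  have row: "(\<Sum>y\<in>insert z B. a x y * ext c v y) = (\<Sum>y\<in>B. a' x y * v y) + a x z * c / d" for x c v
  proof -
    have "(\<Sum>y\<in>B. a x y * ext c v y) = (\<Sum>y\<in>B. a x y * v y)"
      using insert.hyps by (intro sum.cong) (auto simp: ext_def)
    moreover have "(\<Sum>y\<in>B. a' x y * v y) = (\<Sum>y\<in>B. a x y * v y) - a x z / d * (\<Sum>y\<in>B. a z y * v y)"
      by (simp add: a'_def left_diff_distrib sum_subtractf sum_distrib_left mult.assoc)
    ultimately show ?thesis using insert.hyps d
      by (simp add: ext_def diff_divide_distrib right_diff_distrib)
  qed
  have "\<exists>v. \<forall>x\<in>B. (\<Sum>y\<in>B. a' x y * v y) = b' x"
  proof (rule insert.IH)
    fix v :: "'s \<Rightarrow> real" assume v: "\<exists>x\<in>B. v x \<noteq> 0"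
    then have "\<exists>x\<in>insert z B. ext 0 v x \<noteq> 0"
      using insert.hyps by (auto simp: ext_def)
    then have "0 < (\<Sum>x\<in>insert z B. ext 0 v x * (\<Sum>y\<in>insert z B. a x y * ext 0 v y))"
      by (rule insert.prems)
    also have "\<dots> = (\<Sum>x\<in>B. ext 0 v x * (\<Sum>y\<in>B. a' x y * v y))"
      unfolding sum.insert[OF insert.hyps, of "\<lambda>x. ext 0 v x * (\<Sum>y\<in>insert z B. a x y * ext 0 v y)"]
      unfolding row_z by (simp add: row)
    also have "\<dots> = (\<Sum>x\<in>B. v x * (\<Sum>y\<in>B. a' x y * v y))"
      using insert.hyps by (intro sum.cong) (auto simp: ext_def)
    finally show "(\<Sum>x\<in>B. v x * (\<Sum>y\<in>B. a' x y * v y)) > 0" .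
  qed
  then obtain v where v: "\<And>x. x \<in> B \<Longrightarrow> (\<Sum>y\<in>B. a' x y * v y) = b' x" by blast
  have "(\<Sum>y\<in>insert z B. a x y * ext (b z) v y) = b x" if "x \<in> insert z B" for x
  proof (cases "x = z")
    case False
    then show ?thesis using that v[of x] unfolding row by (simp add: b'_def)
  qed (simp only: row_z)
  then show ?case by blast
qed simp

section \<open>Dirichlet forms, maximum principles and effective resistance\<close>

lemma mult_self_le_mult:
  fixes p q :: real
  assumes "p > 0 \<Longrightarrow> p \<le> q" "p < 0 \<Longrightarrow> q \<le> p"
  shows "p * p \<le> q * p"
  using assms by (cases p "0 :: real" rule: linorder_cases) auto

text \<open>\<open>connected\<close> is stated through functions because it is used as injectivity:
  zero energy together with zero values on \<open>A\<close> forces a function to vanish on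
  \<open>S\<close>.\<close>

locale electrical_network =
  fixes S A :: "'s set" and c :: "'s \<Rightarrow> 's \<Rightarrow> real"
  assumes finite_S: "finite S"
    and c_sym: "\<And>x y. c x y = c y x" and c_nonneg: "\<And>x y. x \<in> S \<Longrightarrow> y \<in> S \<Longrightarrow> 0 \<le> c x y"
    and connected: "\<And>v :: 's \<Rightarrow> real. (\<And>x. x \<in> A \<Longrightarrow> v x = 0) \<Longrightarrow>
      (\<And>x y. x \<in> S \<Longrightarrow> y \<in> S \<Longrightarrow> c x y > 0 \<Longrightarrow> v x = v y) \<Longrightarrow> \<forall>x\<in>S. v x = 0"
begin

text \<open>Ordered pairs are summed, so every edge counts twice; this is the source of the factors
  2 below.\<close>

definition dirichlet :: "('s \<Rightarrow> real) \<Rightarrow> ('s \<Rightarrow> real) \<Rightarrow> real" where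
  "dirichlet f g = (\<Sum>x\<in>S. \<Sum>y\<in>S. c x y * (f x - f y) * (g x - g y))"

definition laplace :: "('s \<Rightarrow> real) \<Rightarrow> 's \<Rightarrow> real" where
  "laplace f x = (\<Sum>y\<in>S. c x y * (f x - f y))"

text \<open>Summation by parts: exchanging the two summation variables and using symmetry of
  \<open>c\<close> shows that both halves of \<open>g x - g y\<close> contribute equally.\<close>

lemma green: "dirichlet f g = 2 * (\<Sum>x\<in>S. g x * laplace f x)"
proof -
  have "dirichlet f g = (\<Sum>x\<in>S. \<Sum>y\<in>S. c x y * (f x - f y) * g x) - (\<Sum>x\<in>S. \<Sum>y\<in>S. c x y * (f x - f y) * g y)"
    unfolding dirichlet_def by (simp add: sum_subtractf right_diff_distrib)
  also have "(\<Sum>x\<in>S. \<Sum>y\<in>S. c x y * (f x - f y) * g y) = (\<Sum>x\<in>S. \<Sum>y\<in>S. - (c x y * (f x - f y) * g x))"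
    by (subst sum.swap) (intro sum.cong, auto simp: c_sym algebra_simps)
  finally show ?thesis
    by (simp add: laplace_def sum_negf sum_distrib_left mult_ac)
qed

lemma green_killed:
  assumes "\<And>x. x \<in> A \<Longrightarrow> g x = 0"
  shows "dirichlet f g = 2 * (\<Sum>x\<in>S-A. g x * laplace f x)"
  unfolding green using finite_S assms
  by (intro arg_cong[where f = "\<lambda>s. 2 * s"] sum.mono_neutral_right) auto

lemma dirichlet_sym: "dirichlet f g = dirichlet g f"
  by (simp add: dirichlet_def mult_ac)

lemma dirichlet_edge_le:
  assumes "x \<in> S" "y \<in> S"
  shows "c x y * (f x - f y)\<^sup>2 \<le> dirichlet f f"
proof -
  have nn: "0 \<le> c x y * (f x - f y) * (f x - f y)" if "x \<in> S" "y \<in> S" for x y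
    using c_nonneg[OF that] by (simp add: mult.assoc)
  have "c x y * (f x - f y) * (f x - f y) \<le> (\<Sum>y\<in>S. c x y * (f x - f y) * (f x - f y))"
    using assms finite_S by (intro member_le_sum nn) auto
  also have "\<dots> \<le> dirichlet f f"
    unfolding dirichlet_def using assms finite_S by (intro member_le_sum[of x] sum_nonneg nn) auto
  finally show ?thesis by (simp add: power2_eq_square mult.assoc)
qed

lemma dirichlet_nonneg: "0 \<le> dirichlet f f"
  unfolding dirichlet_def mult.assoc
  by (intro sum_nonneg mult_nonneg_nonneg[OF c_nonneg zero_le_square])

text \<open>Zero energy forces equal values across every edge of positive conductance, and
  connectedness does the rest.\<close>

lemma dirichlet_le_0_imp_0:
  assumes v: "\<And>x. x \<in> A \<Longrightarrow> v x = 0" and "dirichlet v v \<le> 0" and x: "x \<in> S"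
  shows "v x = 0"
proof -
  have "v x = v y" if "x \<in> S" "y \<in> S" "c x y > 0" for x y
  proof -
    have "c x y * (v x - v y)\<^sup>2 \<le> 0"
      using dirichlet_edge_le[OF that(1,2), of v] assms(2) by linarith
    then have "(v x - v y)\<^sup>2 \<le> 0" using that(3) by (simp add: mult_le_0_iff)
    then show ?thesis by simp
  qed
  then show ?thesis using connected[of v] v x by blast
qed

text \<open>The Laplacian restricted to \<open>S - A\<close> is positive definite: its quadratic
  form is half the energy of the extension by zero, which vanishes only for the zero
  function.\<close>

lemma poisson_solvable:
  obtains v where "\<And>x. x \<in> S - A \<Longrightarrow> laplace v x = b x" "\<And>x. x \<in> A \<Longrightarrow> v x = 0"
proof -
  \<comment> \<open>The diagonal sums over all of \<open>S\<close>, so edges into \<open>A\<close>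
    act as killing.\<close>
  define m where "m x y = (if x = y then (\<Sum>z\<in>S. c x z) else 0) - c x y" for x y
  define ext :: "('s \<Rightarrow> real) \<Rightarrow> 's \<Rightarrow> real" where "ext v x = (if x \<in> S - A then v x else 0)" for v x
  have fin: "finite (S - A)" using finite_S by simp
  have lap: "laplace (ext v) x = (\<Sum>y\<in>S-A. m x y * v y)" if x: "x \<in> S - A" for v x
  proof -
    have "(\<Sum>y\<in>S. c x y * ext v y) = (\<Sum>y\<in>S-A. c x y * v y)"
      using finite_S by (intro sum.mono_neutral_cong_right) (auto simp: ext_def)
    moreover have "(\<Sum>y\<in>S-A. (if x = y then (\<Sum>z\<in>S. c x z) else 0) * v y) = (\<Sum>z\<in>S. c x z) * v x"
      using x fin by (simp add: if_distrib[of "\<lambda>s. s * _"] cong: if_cong)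
    ultimately show ?thesis using x
      unfolding laplace_def m_def
      by (simp add: ext_def left_diff_distrib right_diff_distrib sum_subtractf sum_distrib_right)
  qed
  have "\<exists>v. \<forall>x\<in>S-A. (\<Sum>y\<in>S-A. m x y * v y) = b x"
  proof (rule positive_definite_solvable[OF fin])
    fix v :: "'s \<Rightarrow> real" assume "\<exists>x\<in>S - A. v x \<noteq> 0"
    then obtain x where x: "x \<in> S - A" "v x \<noteq> 0" by blast
    have "\<not> dirichlet (ext v) (ext v) \<le> 0"
      using dirichlet_le_0_imp_0[of "ext v" x] x by (auto simp: ext_def)
    moreover have "dirichlet (ext v) (ext v) = 2 * (\<Sum>x\<in>S-A. ext v x * laplace (ext v) x)"
      by (rule green_killed) (simp add: ext_def)
    moreover have "\<dots> = 2 * (\<Sum>x\<in>S-A. v x * (\<Sum>y\<in>S-A. m x y * v y))"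
      by (simp add: lap) (intro sum.cong, auto simp: ext_def)
    ultimately show "0 < (\<Sum>x\<in>S-A. v x * (\<Sum>y\<in>S-A. m x y * v y))" by simp
  qed
  then obtain v where "\<forall>x\<in>S-A. (\<Sum>y\<in>S-A. m x y * v y) = b x" ..
  then show thesis using that[of "ext v"] lap by (auto simp: ext_def)
qed

text \<open>Minimum principle by energy: testing \<open>v\<close> against its own negative part
  \<open>m\<close> gives \<open>dirichlet m m \<le> dirichlet v m \<le> 0\<close>, so
  \<open>m\<close> vanishes.\<close>

lemma superharmonic_nonneg:
  assumes v: "\<And>x. x \<in> A \<Longrightarrow> v x = 0" and lap: "\<And>x. x \<in> S - A \<Longrightarrow> laplace v x \<ge> 0" and x: "x \<in> S"
  shows "v x \<ge> 0"
proof -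
  define m where "m x = min (v x) 0" for x
  have m0: "m x = 0" if "x \<in> A" for x using v[OF that] by (simp add: m_def)
  have "dirichlet m m \<le> dirichlet v m"
    unfolding dirichlet_def mult.assoc
  proof (intro sum_mono mult_left_mono c_nonneg)
    fix x y
    \<comment> \<open>A truncated increment is zero or has the sign of the original one, and is no
      larger in size.\<close>
    show "(m x - m y) * (m x - m y) \<le> (v x - v y) * (m x - m y)"
      by (rule mult_self_le_mult) (auto simp: m_def)
  qed
  also have "\<dots> = 2 * (\<Sum>x\<in>S-A. m x * laplace v x)" using m0 by (rule green_killed)
  also have "\<dots> \<le> 0"
  proof -
    have "(\<Sum>x\<in>S-A. m x * laplace v x) \<le> 0"
      by (intro sum_nonpos mult_nonpos_nonneg lap) (auto simp: m_def)
    then show ?thesis by simp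
  qed
  finally have "m x = 0" using dirichlet_le_0_imp_0[of m x] m0 x by blast
  then show ?thesis by (simp add: m_def min_def split: if_splits)
qed

text \<open>The potential of a unit current entering at \<open>s\<close> outside \<open>A\<close>,
  with \<open>A\<close> grounded; \<open>u s\<close> is the effective resistance between
  them.\<close>

definition is_green :: "'s \<Rightarrow> ('s \<Rightarrow> real) \<Rightarrow> bool" where
  "is_green s u \<longleftrightarrow> (\<forall>x\<in>S-A. laplace u x = of_bool (x = s)) \<and> (\<forall>x\<in>A. u x = 0)"

lemma green_function_nonneg: "is_green s u \<Longrightarrow> x \<in> S \<Longrightarrow> u x \<ge> 0"
  by (rule superharmonic_nonneg) (auto simp: is_green_def)

text \<open>Reproducing property: in \<open>green_killed\<close> only the term at \<open>s\<close>
  survives.\<close>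

lemma dirichlet_green:
  assumes u: "is_green s u" and s: "s \<in> S - A" and g: "\<And>x. x \<in> A \<Longrightarrow> g x = 0"
  shows "dirichlet u g = 2 * g s"
proof -
  have "(\<Sum>x\<in>S-A. g x * laplace u x) = (\<Sum>x\<in>S-A. if x = s then g x else 0)"
    using u by (intro sum.cong) (auto simp: is_green_def)
  then show ?thesis using s finite_S by (simp add: green_killed[of g, OF g])
qed

text \<open>Maximum principle: the excess of \<open>u\<close> over \<open>u s\<close> vanishes at
  \<open>s\<close> and on \<open>A\<close>, so its pairing with \<open>u\<close> is zero by the
  reproducing property, and this pairing dominates its own energy.\<close>

lemma green_function_le:
  assumes u: "is_green s u" and s: "s \<in> S - A" and x: "x \<in> S"
  shows "u x \<le> u s"
proof -
  define m where "m x = max (u x - u s) 0" for x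
  have us: "u s \<ge> 0" using green_function_nonneg[OF u] s by simp
  then have m0: "m x = 0" if "x \<in> A" for x using u that by (simp add: m_def is_green_def)
  have "dirichlet m m \<le> dirichlet u m"
    unfolding dirichlet_def mult.assoc
  proof (intro sum_mono mult_left_mono c_nonneg)
    fix x y
    show "(m x - m y) * (m x - m y) \<le> (u x - u y) * (m x - m y)"
      by (rule mult_self_le_mult) (auto simp: m_def)
  qed
  also have "\<dots> = 0" using dirichlet_green[OF u s, of m] m0 by (simp add: m_def)
  finally have "m x = 0" using dirichlet_le_0_imp_0[of m x] m0 x by blast
  then show ?thesis by (simp add: m_def max_def split: if_splits)
qed

text \<open>The pairing of \<open>f\<close> and \<open>u\<close> is evaluated twice: with
  \<open>u\<close> as Green function, and through the Laplacian of \<open>f\<close>.\<close>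

lemma poisson_eq_green_sum:
  assumes u: "is_green s u" and s: "s \<in> S - A"
    and f: "\<And>x. x \<in> S - A \<Longrightarrow> laplace f x = b x" "\<And>x. x \<in> A \<Longrightarrow> f x = 0"
  shows "f s = (\<Sum>x\<in>S-A. b x * u x)"
proof -
  have "2 * f s = dirichlet f u"
    using dirichlet_green[OF u s, of f] f(2) by (simp add: dirichlet_sym)
  also have "\<dots> = 2 * (\<Sum>x\<in>S-A. u x * laplace f x)"
    using u by (intro green_killed) (auto simp: is_green_def)
  finally show ?thesis by (simp add: f(1) mult.commute)
qed

text \<open>The energy of \<open>u\<close> is \<open>2 * u s\<close>, so an edge of conductance at
  least \<open>\<kappa>\<close> carries a drop of at most \<open>r\<close>. Summing the drops along
  \<open>w\<close> from \<open>u s\<close> down to 0 bounds \<open>u s\<close> by a multiple of its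
  own square root.\<close>

lemma green_function_upper:
  assumes u: "is_green s u" and s: "s \<in> S - A"
    and w: "w \<noteq> []" "set w \<subseteq> S" "hd w = s" "last w \<in> A"
    and edge: "\<And>k. Suc k < length w \<Longrightarrow> \<kappa> \<le> c (w ! k) (w ! Suc k)" and \<kappa>: "\<kappa> > 0"
  shows "u s \<le> 2 * real (length w) ^ 2 / \<kappa>"
proof -
  have us: "u s \<ge> 0" using green_function_nonneg[OF u] s by simp
  have D: "dirichlet u u = 2 * u s" using dirichlet_green[OF u s, of u] u by (simp add: is_green_def)
  define r where "r = sqrt (2 * u s / \<kappa>)"
  have drop: "u (w ! k) - u (w ! Suc k) \<le> r" if k: "Suc k < length w" for k
  proof -
    have "w ! k \<in> S" "w ! Suc k \<in> S" using w(2) k nth_mem[of k w] nth_mem[of "Suc k" w] by auto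
    then have "c (w ! k) (w ! Suc k) * (u (w ! k) - u (w ! Suc k))\<^sup>2 \<le> 2 * u s"
      using dirichlet_edge_le[of "w ! k" "w ! Suc k" u] D by simp
    moreover have "\<kappa> * (u (w ! k) - u (w ! Suc k))\<^sup>2 \<le> c (w ! k) (w ! Suc k) * (u (w ! k) - u (w ! Suc k))\<^sup>2"
      using edge[OF k] by (rule mult_right_mono) simp
    ultimately have "(u (w ! k) - u (w ! Suc k))\<^sup>2 \<le> 2 * u s / \<kappa>"
      using \<kappa> by (simp add: pos_le_divide_eq mult.commute)
    then show ?thesis unfolding r_def by (rule real_le_rsqrt)
  qed
  have "u (w ! 0) - u (w ! k) \<le> real k * r" if "k < length w" for k
    using that
  proof (induction k)
    case (Suc k)
    then show ?case using drop[of k] by (simp add: algebra_simps)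
  qed simp
  from this[of "length w - 1"] have "u s \<le> real (length w - 1) * r"
    using w u by (simp add: hd_conv_nth last_conv_nth is_green_def)
  also have "\<dots> \<le> real (length w) * r"
    by (intro mult_right_mono) (auto simp: r_def us \<kappa> less_imp_le)
  finally have "u s ^ 2 \<le> (real (length w) * r) ^ 2" using us by (intro power_mono)
  also have "\<dots> = u s * (2 * real (length w) ^ 2 / \<kappa>)"
    using us \<kappa> by (simp add: power_mult_distrib r_def)
  finally have *: "u s * u s \<le> u s * (2 * real (length w) ^ 2 / \<kappa>)" by (simp only: power2_eq_square)
  show ?thesis
  proof (cases "u s = 0")
    case False
    with us have "u s > 0" by simp
    then show ?thesis using * by (rule mult_left_le_imp_le[rotated])
  qed (use \<kappa> in simp)
qed

lemma green_function_lower: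
  assumes u: "is_green s u" and s: "s \<in> S - A"
    and W: "s \<in> W" "W \<inter> A = {}"
    and cut: "\<And>x y. x \<in> S \<inter> W \<Longrightarrow> y \<in> S - W \<Longrightarrow> c x y \<le> \<kappa>" and \<kappa>: "\<kappa> > 0"
  shows "2 / (real (card S) ^ 2 * \<kappa>) \<le> u s"
proof -
  \<comment> \<open>Dirichlet's principle with test function \<open>g\<close>: expand \<open>dirichlet (u - t g) (u - t g) \<ge> 0\<close> at
    the value \<open>t = 2 / K\<close> suggested by minimisation.\<close>
  define g :: "'s \<Rightarrow> real" where "g x = of_bool (x \<in> W)" for x
  define K where "K = real (card S) ^ 2 * \<kappa>"
  have "card S > 0" using s finite_S by (auto simp: card_gt_0_iff)
  then have K: "K > 0" using \<kappa> by (simp add: K_def)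
  \<comment> \<open>Only pairs separated by \<open>W\<close> contribute, each at most
    \<open>\<kappa>\<close>; there are at most \<open>card S\<close> squared of them.\<close>
  have Dg: "dirichlet g g \<le> K"
  proof -
    have "dirichlet g g \<le> (\<Sum>x\<in>S. \<Sum>y\<in>S. \<kappa>)"
      unfolding dirichlet_def
    proof (intro sum_mono)
      fix x y assume "x \<in> S" "y \<in> S"
      then show "c x y * (g x - g y) * (g x - g y) \<le> \<kappa>"
        using cut[of x y] cut[of y x] \<kappa> by (auto simp: g_def c_sym[of x y])
    qed
    also have "\<dots> = K" by (simp add: K_def power2_eq_square)
    finally show ?thesis .
  qed
  define t where "t = 2 / K"
  have "0 \<le> dirichlet (\<lambda>x. u x - t * g x) (\<lambda>x. u x - t * g x)" by (rule dirichlet_nonneg)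
  also have "\<dots> = dirichlet u u - 2 * t * dirichlet u g + t\<^sup>2 * dirichlet g g"
    unfolding dirichlet_def sum_distrib_left sum_subtractf[symmetric] sum.distrib[symmetric]
    by (intro sum.cong refl) (simp add: algebra_simps power2_eq_square)
  also have "dirichlet u u = 2 * u s"
    using dirichlet_green[OF u s, of u] u by (simp add: is_green_def)
  also have "dirichlet u g = 2"
    using dirichlet_green[OF u s, of g] W by (auto simp: g_def)
  also have "t\<^sup>2 * dirichlet g g \<le> t\<^sup>2 * K" using Dg by (intro mult_left_mono) auto
  also have "t\<^sup>2 * K = 2 * t" using K by (simp add: t_def power2_eq_square)
  finally have "t \<le> u s" by simp
  then show ?thesis by (simp add: t_def K_def)
qed

end

section \<open>Communication heights\<close>

definition activation :: "nat \<Rightarrow> nat \<Rightarrow> (nat \<Rightarrow> nat) \<Rightarrow> (nat \<Rightarrow> nat) \<Rightarrow> bool" where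
  "activation N C x y \<longleftrightarrow> (\<exists>i\<in>{1..N}. \<exists>c\<in>{1..C}. x i = 0 \<and> y = x(i := c))"

definition neighbours :: "nat \<Rightarrow> nat \<Rightarrow> (nat \<Rightarrow> nat) \<Rightarrow> (nat \<Rightarrow> nat) \<Rightarrow> bool" where
  "neighbours N C x y \<longleftrightarrow> activation N C x y \<or> activation N C y x"

lemma neighbours_sym: "neighbours N C x y \<longleftrightarrow> neighbours N C y x"
  by (auto simp: neighbours_def)

lemma activity_activation:
  assumes "activation N C x y"
  shows "activity N y = Suc (activity N x)"
proof -
  obtain i c where *: "i \<in> {1..N}" "c \<ge> 1" "x i = 0" "y = x(i := c)"
    using assms by (auto simp: activation_def)
  then have "{j \<in> {1..N}. y j \<noteq> 0} = insert i {j \<in> {1..N}. x j \<noteq> 0}" by auto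
  with * show ?thesis by (simp add: activity_def)
qed

text \<open>A deactivation is a reversed activation, so a single relation describes both kinds of
  transition.\<close>

lemma rate_eq:
  "rate N C \<nu> x y = (if activation N C x y then \<nu> else if activation N C y x then 1 else 0)"
proof -
  have "(\<exists>i\<in>{1..N}. \<exists>c\<in>{1..C}. x i = c \<and> y = x(i := 0)) \<longleftrightarrow> activation N C y x"
  proof
    assume "\<exists>i\<in>{1..N}. \<exists>c\<in>{1..C}. x i = c \<and> y = x(i := 0)"
    then show "activation N C y x"
      unfolding activation_def by (metis fun_upd_same fun_upd_triv fun_upd_upd)
  next
    assume "activation N C y x"
    then show "\<exists>i\<in>{1..N}. \<exists>c\<in>{1..C}. x i = c \<and> y = x(i := 0)"
      unfolding activation_def by (metis fun_upd_same fun_upd_triv fun_upd_upd)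
  qed
  then show ?thesis by (simp only: rate_def flip: activation_def)
qed

lemma is_path_iff:
  "is_path N C E w x y \<longleftrightarrow>
     w \<noteq> [] \<and> set w \<subseteq> states N C E \<and> hd w = x \<and> last w = y \<and> successively (neighbours N C) w"
proof -
  have "(\<forall>\<nu>>1. rate N C \<nu> x y > 0) \<longleftrightarrow> neighbours N C x y" for x y
  proof
    assume "\<forall>\<nu>>1. rate N C \<nu> x y > 0"
    then have "rate N C 2 x y > 0" by simp
    then show "neighbours N C x y" by (simp add: rate_eq neighbours_def split: if_splits)
  qed (auto simp: rate_eq neighbours_def)
  then show ?thesis by (simp add: is_path_def successively_conv_nth)
qed

lemma is_path_snoc:
  assumes "is_path N C E w x y" "neighbours N C y z" "z \<in> states N C E"
  shows "is_path N C E (w @ [z]) x z"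
  using assms by (auto simp: is_path_iff successively_append_iff)

lemma finite_states: "finite (states N C E)"
  by (rule finite_subset[of _ "{1..N} \<rightarrow>\<^sub>E {0..C}"]) (auto simp: states_def intro!: finite_PiE)

lemma activity_le_max: "x \<in> states N C E \<Longrightarrow> activity N x \<le> max_activity N C E"
  unfolding max_activity_def using finite_states by (intro Max_ge) auto

lemma states_deactivate:
  assumes x: "x \<in> states N C E" and j: "j \<in> {1..N}"
  shows "x(j := 0) \<in> states N C E"
proof -
  have "x(j := 0) \<in> {1..N} \<rightarrow>\<^sub>E {0..C}"
    using x j by (auto simp: states_def PiE_iff extensional_def)
  moreover have "\<not> ((x(j := 0)) k = c \<and> (x(j := 0)) l = c)" if "c \<in> {1..C}" "(k, l) \<in> E c" for c k l
    using x that unfolding states_def by (auto split: if_splits)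
  ultimately show ?thesis unfolding states_def by blast
qed

text \<open>Switching a node off never violates feasibility, so a state can be emptied one node at a
  time; induction on the activity.\<close>

lemma path_to_idle:
  assumes "x \<in> states N C E"
  shows "\<exists>w. is_path N C E w x (restrict (\<lambda>_. 0) {1..N})"
  using assms
proof (induction "activity N x" arbitrary: x rule: less_induct)
  case less
  show ?case
  proof (cases "\<exists>j\<in>{1..N}. x j \<noteq> 0")
    case True
    then obtain j where j: "j \<in> {1..N}" "x j \<noteq> 0" by blast
    define y where "y = x(j := 0)"
    have y: "y \<in> states N C E" using less.prems j by (simp add: y_def states_deactivate)
    have "x j \<in> {1..C}" using less.prems j by (auto simp: states_def PiE_iff)
    then have up: "activation N C y x"
      unfolding activation_def y_def using j by (metis fun_upd_same fun_upd_triv fun_upd_upd)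
    then obtain w where w: "is_path N C E w y (restrict (\<lambda>_. 0) {1..N})"
      using less.hyps[of y] y activity_activation[OF up] by auto
    have "is_path N C E (x # w) x (restrict (\<lambda>_. 0) {1..N})"
      using w up less.prems by (auto simp: is_path_iff successively_Cons neighbours_def)
    then show ?thesis ..
  next
    case False
    then have "x = restrict (\<lambda>_. 0) {1..N}"
      using less.prems by (auto simp: states_def PiE_iff extensional_def fun_eq_iff)
    then have "is_path N C E [x] x (restrict (\<lambda>_. 0) {1..N})"
      using less.prems by (simp add: is_path_iff)
    then show ?thesis ..
  qed
qed

text \<open>Go through the idle state, reversing the path from \<open>y\<close>; \<open>tl\<close>
  drops the repeated idle state.\<close>

lemma path_exists:
  assumes "x \<in> states N C E" "y \<in> states N C E"
  shows "\<exists>w. is_path N C E w x y"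
proof -
  obtain v w where v: "is_path N C E v x (restrict (\<lambda>_. 0) {1..N})"
    and w: "is_path N C E w y (restrict (\<lambda>_. 0) {1..N})"
    using assms path_to_idle by meson
  have "is_path N C E (v @ tl (rev w)) x y"
  proof -
    obtain u where u: "rev w = restrict (\<lambda>_. 0) {1..N} # u"
      using w by (cases "rev w") (auto simp: is_path_iff simp flip: hd_rev)
    have "successively (neighbours N C) (rev w)"
      using w unfolding is_path_iff successively_rev
      by (auto elim!: successively_mono simp: neighbours_sym)
    moreover have "last (rev w) = y" using w by (simp add: is_path_iff last_rev)
    moreover have "set (rev w) \<subseteq> states N C E" using w by (simp add: is_path_iff)
    ultimately show ?thesis using v unfolding u
      by (auto simp: is_path_iff successively_append_iff successively_Cons)
  qed
  then show ?thesis ..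
qed

section \<open>Heights of paths and their attained minimum\<close>

definition path_height :: "nat \<Rightarrow> nat \<Rightarrow> (nat \<Rightarrow> (nat \<times> nat) set) \<Rightarrow> (nat \<Rightarrow> nat) list \<Rightarrow> int" where
  "path_height N C E w = Max ((\<lambda>z. int (max_activity N C E) - int (activity N z)) ` set w)"

lemma path_height_le_iff:
  "w \<noteq> [] \<Longrightarrow> path_height N C E w \<le> h \<longleftrightarrow>
     (\<forall>z\<in>set w. int (max_activity N C E) - int (activity N z) \<le> h)"
  unfolding path_height_def by (subst Max_le_iff) auto

lemma path_height_bounds:
  assumes "is_path N C E w x y"
  shows "path_height N C E w \<in> {0..int (max_activity N C E)}"
proof -
  have "path_height N C E w \<in> (\<lambda>z. int (max_activity N C E) - int (activity N z)) ` set w"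
    unfolding path_height_def using assms by (intro Max_in) (auto simp: is_path_iff)
  then show ?thesis using assms activity_le_max by (auto simp: is_path_iff)
qed

text \<open>There may be infinitely many paths, but their heights lie in a finite range, so
  \<open>Min\<close> ranges over a finite nonempty set and is attained.\<close>

lemma comm_height_witness:
  assumes "x \<in> states N C E" "y \<in> states N C E"
  shows "\<exists>w. is_path N C E w x y \<and> path_height N C E w = comm_height N C E x y"
    and "is_path N C E w x y \<Longrightarrow> comm_height N C E x y \<le> path_height N C E w"
proof -
  let ?H = "{path_height N C E w | w. is_path N C E w x y}"
  have eq: "comm_height N C E x y = Min ?H" by (simp add: comm_height_def path_height_def)
  have fin: "finite ?H"
    by (rule finite_subset[of _ "{0..int (max_activity N C E)}"]) (use path_height_bounds in auto)
  moreover have "?H \<noteq> {}" using path_exists[OF assms] by auto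
  ultimately have "Min ?H \<in> ?H" by (rule Min_in)
  then show "\<exists>w. is_path N C E w x y \<and> path_height N C E w = comm_height N C E x y"
    unfolding eq by auto
  show "is_path N C E w x y \<Longrightarrow> comm_height N C E x y \<le> path_height N C E w"
    unfolding eq using fin by (intro Min_le) auto
qed

section \<open>The state graph as an electrical network, and the hitting time bounds\<close>

definition conductance :: "nat \<Rightarrow> nat \<Rightarrow> real \<Rightarrow> (nat \<Rightarrow> nat) \<Rightarrow> (nat \<Rightarrow> nat) \<Rightarrow> real" where
  "conductance N C \<nu> x y = (if neighbours N C x y then \<nu> ^ max (activity N x) (activity N y) else 0)"

text \<open>Detailed balance with respect to the weights \<open>\<nu> ^ activity N x\<close>.\<close>

lemma conductance_eq: "conductance N C \<nu> x y = \<nu> ^ activity N x * rate N C \<nu> x y"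
proof -
  consider "activation N C x y" | "\<not> activation N C x y" "activation N C y x"
    | "\<not> activation N C x y" "\<not> activation N C y x" by blast
  then show ?thesis
    by cases (simp_all add: conductance_def rate_eq neighbours_def activity_activation)
qed

text \<open>Any state is joined to \<open>A\<close> by a path, along which a function with no jumps
  across edges is constant.\<close>

lemma electrical_network_conductance:
  assumes A: "A \<subseteq> states N C E" "A \<noteq> {}" and \<nu>: "\<nu> > 1"
  shows "electrical_network (states N C E) A (conductance N C \<nu>)"
proof
  fix v :: "(nat \<Rightarrow> nat) \<Rightarrow> real"
  assume v: "\<And>x. x \<in> A \<Longrightarrow> v x = 0"
    and edge: "\<And>x y. x \<in> states N C E \<Longrightarrow> y \<in> states N C E \<Longrightarrow> 0 < conductance N C \<nu> x y \<Longrightarrow> v x = v y"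
  have const: "v x = v (last (x # w))"
    if "set (x # w) \<subseteq> states N C E" "successively (neighbours N C) (x # w)" for x w
    using that
  proof (induction w arbitrary: x)
    case (Cons y w)
    have "v x = v y" using Cons.prems \<nu> by (intro edge) (auto simp: conductance_def)
    then show ?case using Cons by simp
  qed simp
  show "\<forall>x\<in>states N C E. v x = 0"
  proof
    fix x assume x: "x \<in> states N C E"
    obtain y where y: "y \<in> A" using A by blast
    then obtain w where w: "is_path N C E w x y" using path_exists[OF x, of y] A by blast
    then obtain w' where "w = x # w'" by (cases w) (auto simp: is_path_iff)
    then show "v x = 0" using const[of x w'] w v[OF y] by (auto simp: is_path_iff)
  qed
qed (use A \<nu> in \<open>auto simp: finite_states conductance_def neighbours_sym max.commute\<close>)

lemma neighbours_activity:
  "neighbours N C x y \<Longrightarrow> activity N y = Suc (activity N x) \<or> activity N x = Suc (activity N y)"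
  unfolding neighbours_def using activity_activation by blast

text \<open>The constants are chosen before \<open>\<nu>\<close>, \<open>M\<close> and
  \<open>X\<close>, hence are uniform in them; \<open>1 \<le> \<Gamma>\<close> makes the truncation
  in \<open>nat (\<Gamma> - 1)\<close> harmless.\<close>

lemma expected_hitting_time_bounds:
  fixes A N C E s
  defines "\<Gamma> \<equiv> Min (comm_height N C E s ` A)"
  assumes A: "A \<subseteq> dominant N C E" "A \<noteq> {}" and s: "s \<in> dominant N C E - A"
  shows "1 \<le> \<Gamma>"
    and "\<exists>k K. 0 < k \<and> 0 < K \<and> (\<forall>\<nu>>1. \<forall>(M :: 'w measure) X.
      markov_process (states N C E) (rate N C \<nu>) s M X \<longrightarrow>
      (\<exists>r. expected_hitting_time M X A = ennreal r \<and> k * \<nu> ^ nat (\<Gamma> - 1) \<le> r \<and> r \<le> K * \<nu> ^ nat (\<Gamma> - 1)))"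
proof -
  define S where "S = states N C E"
  define m where "m = max_activity N C E"
  have AS: "A \<subseteq> S" using A by (auto simp: dominant_def S_def)
  have sS: "s \<in> S - A" and am: "activity N s = m" using s by (auto simp: dominant_def S_def m_def)
  have finS: "finite S" unfolding S_def by (rule finite_states)
  have finA: "finite A" using AS finS by (rule finite_subset)
  have "\<Gamma> \<in> comm_height N C E s ` A"
    unfolding \<Gamma>_def using finA A by (intro Min_in) auto
  then obtain s' where s': "s' \<in> A" "\<Gamma> = comm_height N C E s s'" by blast
  then obtain w where w: "is_path N C E w s s'" and height_w: "path_height N C E w = \<Gamma>"
    using comm_height_witness(1)[of s N C E s'] sS AS by (auto simp: S_def)
  have w_act: "int m - int (activity N z) \<le> \<Gamma>" if "z \<in> set w" for z
    using path_height_le_iff[of w N C E \<Gamma>] w height_w that by (auto simp: is_path_iff m_def)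
  have optimal: "\<Gamma> \<le> path_height N C E v" if "is_path N C E v s y" "y \<in> A" for v y
  proof -
    have "\<Gamma> \<le> comm_height N C E s y" unfolding \<Gamma>_def using finA that by (intro Min_le) auto
    also have "\<dots> \<le> path_height N C E v"
      using that sS AS by (intro comm_height_witness(2)) (auto simp: S_def)
    finally show ?thesis .
  qed
  \<comment> \<open>A path from \<open>s\<close> to \<open>A\<close> has to leave \<open>s\<close>,
    and every feasible neighbour of a dominant state has one active node fewer.\<close>
  show \<Gamma>1: "1 \<le> \<Gamma>"
  proof -
    have "w \<noteq> [s]"
    proof
      assume "w = [s]"
      then have "s = s'" using w by (simp add: is_path_iff)
      then show False using s'(1) sS by simp
    qed
    moreover have "hd w = s" "w \<noteq> []" using w by (auto simp: is_path_iff)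
    ultimately obtain z w' where w_eq: "w = s # z # w'" by (metis list.exhaust list.sel(1))
    then have "neighbours N C s z" "z \<in> states N C E" using w by (auto simp: is_path_iff)
    then have "Suc (activity N z) = m"
      using neighbours_activity[of N C s z] activity_le_max[of z N C E] am by (auto simp: m_def)
    then show ?thesis using w_act[of z] w_eq by auto
  qed
  define g where "g = nat (\<Gamma> - 1)"
  have \<Gamma>g: "\<Gamma> = int g + 1" using \<Gamma>1 by (simp add: g_def)
  \<comment> \<open>Ensures that the natural number difference \<open>m - g\<close> below is not
    truncated.\<close>
  have gm: "Suc g \<le> m"
    using path_height_bounds[OF w] height_w by (simp add: \<Gamma>g m_def)
  \<comment> \<open>\<open>k\<close> and \<open>K\<close> are what remains of the Green function
    bounds after multiplication by \<open>\<nu> ^ m = \<kappa> * \<nu> ^ g\<close>; the extra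
    \<open>card S\<close> in \<open>K\<close> bounds the number of terms of the Green sum.\<close>
  define k where "k = 2 / real (card S) ^ 2"
  define K where "K = 2 * real (card S) * real (length w) ^ 2"
  have cS: "card S > 0" using sS finS by (auto simp: card_gt_0_iff)
  have kK: "k > 0" "K > 0" using cS w by (auto simp: k_def K_def is_path_iff)
  have "\<exists>r. expected_hitting_time M X A = ennreal r \<and> k * \<nu> ^ g \<le> r \<and> r \<le> K * \<nu> ^ g"
    if \<nu>: "\<nu> > 1" and mp: "markov_process S (rate N C \<nu>) s M X" for \<nu> and M :: "'w measure" and X
  proof -
    interpret electrical_network S A "conductance N C \<nu>"
      unfolding S_def using AS A \<nu> by (intro electrical_network_conductance) (auto simp: S_def)
    \<comment> \<open>The critical conductance: that of an edge whose upper endpoint has activity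
      \<open>m - g\<close>, one above the lowest level of an optimal path.\<close>
    define \<kappa> where "\<kappa> = \<nu> ^ (m - g)"
    have \<kappa>: "\<kappa> > 0" using \<nu> by (simp add: \<kappa>_def)
    have \<kappa>g: "\<nu> ^ m = \<kappa> * \<nu> ^ g" using gm by (simp add: \<kappa>_def flip: power_add)
    obtain u where u: "is_green s u"
      using poisson_solvable[of "\<lambda>x. of_bool (x = s)"] unfolding is_green_def by metis
    \<comment> \<open>By detailed balance \<open>laplace\<close> is minus the weight times the
      generator, so the equation with right-hand side \<open>- 1\<close> acquires the weight as its
      source.\<close>
    obtain f where f: "\<And>x. x \<in> S - A \<Longrightarrow> laplace f x = \<nu> ^ activity N x" "\<And>x. x \<in> A \<Longrightarrow> f x = 0"
      using poisson_solvable[of "\<lambda>x. \<nu> ^ activity N x"] by metis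
    have "expected_hitting_time M X A = ennreal (f s)"
    proof (rule expected_hitting_time_eq[where f = f, OF finS mp AS sS])
      fix x assume x: "x \<in> S - A"
      show "0 \<le> f x"
        by (rule superharmonic_nonneg[of f]) (use x f \<nu> in auto)
      have "\<nu> ^ activity N x * (\<Sum>y\<in>S. rate N C \<nu> x y * (f y - f x)) = - laplace f x"
        unfolding laplace_def sum_distrib_left sum_negf[symmetric]
        by (intro sum.cong) (auto simp: conductance_eq algebra_simps)
      also have "\<dots> = \<nu> ^ activity N x * (- 1)" using f(1)[OF x] by simp
      finally show "(\<Sum>y\<in>S. rate N C \<nu> x y * (f y - f x)) = - 1"
        using \<nu> by (subst (asm) mult_cancel_left) auto
    qed (use f in auto)
    moreover have fs: "f s = (\<Sum>x\<in>S-A. \<nu> ^ activity N x * u x)"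
      by (rule poisson_eq_green_sum[OF u sS f])
    have "f s \<le> K * \<nu> ^ g"
    proof -
      have us: "u s \<le> 2 * real (length w) ^ 2 / \<kappa>"
      proof (rule green_function_upper[OF u sS])
        fix j assume j: "Suc j < length w"
        have nb: "neighbours N C (w ! j) (w ! Suc j)"
          using w j by (simp add: is_path_iff successively_conv_nth)
        \<comment> \<open>States on \<open>w\<close> have activity at least
          \<open>m - g - 1\<close>, and adjacent activities differ by 1, so the larger one reaches
          \<open>m - g\<close>.\<close>
        have "m - g \<le> max (activity N (w ! j)) (activity N (w ! Suc j))"
          using neighbours_activity[OF nb] w_act[OF nth_mem[of j w]] w_act[OF nth_mem[OF j]] j \<Gamma>g by auto
        then show "\<kappa> \<le> conductance N C \<nu> (w ! j) (w ! Suc j)"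
          using nb \<nu> by (simp add: conductance_def \<kappa>_def power_increasing)
      qed (use w s' \<kappa> in \<open>auto simp: is_path_iff S_def\<close>)
      have "f s \<le> (\<Sum>x\<in>S-A. \<nu> ^ m * u s)"
        unfolding fs
      proof (rule sum_mono)
        fix x assume x: "x \<in> S - A"
        show "\<nu> ^ activity N x * u x \<le> \<nu> ^ m * u s"
          using x \<nu> green_function_le[OF u sS, of x] green_function_nonneg[OF u, of x]
          by (intro mult_mono power_increasing) (auto simp: S_def m_def activity_le_max)
      qed
      also have "\<dots> \<le> real (card S) * (\<nu> ^ m * u s)"
        using finS \<nu> green_function_nonneg[OF u, of s] sS
        by (simp add: mult_right_mono card_mono)
      also have "\<dots> \<le> real (card S) * (\<nu> ^ m * (2 * real (length w) ^ 2 / \<kappa>))"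
        using us \<nu> by (intro mult_left_mono) auto
      also have "\<dots> = K * \<nu> ^ g" using \<kappa> by (simp add: \<kappa>g K_def)
      finally show ?thesis .
    qed
    moreover have "k * \<nu> ^ g \<le> f s"
    proof -
      \<comment> \<open>The well of \<open>s\<close>: every edge leaving it has conductance at most \<open>\<kappa>\<close>.\<close>
      define W where "W = {x. \<exists>v. is_path N C E v s x \<and> path_height N C E v < \<Gamma>}"
      have us: "2 / (real (card S) ^ 2 * \<kappa>) \<le> u s"
      proof (rule green_function_lower[OF u sS _ _ _ \<kappa>])
        have "path_height N C E [s] = 0" using am by (simp add: path_height_def m_def)
        then have "is_path N C E [s] s s \<and> path_height N C E [s] < \<Gamma>"
          using sS \<Gamma>1 by (simp add: is_path_iff S_def)
        then show "s \<in> W" unfolding W_def by blast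
        show "W \<inter> A = {}" using optimal by (fastforce simp: W_def)
        fix x y assume x: "x \<in> S \<inter> W" and y: "y \<in> S - W"
        show "conductance N C \<nu> x y \<le> \<kappa>"
        proof (cases "neighbours N C x y")
          case True
          obtain v where v: "is_path N C E v s x" "path_height N C E v < \<Gamma>"
            using x by (auto simp: W_def)
          have "is_path N C E (v @ [y]) s y"
            using v True y by (intro is_path_snoc) (auto simp: S_def)
          \<comment> \<open>Appending \<open>y\<close> must raise the height to at least
            \<open>\<Gamma>\<close>, as \<open>y\<close> lies outside the well; since
            \<open>v\<close> stays lower, \<open>y\<close> itself has activity at most
            \<open>m - g - 1\<close>.\<close>
          then have "\<not> path_height N C E (v @ [y]) \<le> \<Gamma> - 1"
            using y by (auto simp: W_def)
          then have "int m - int (activity N y) > \<Gamma> - 1"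
            using v path_height_le_iff[of v N C E "\<Gamma> - 1"] path_height_le_iff[of "v @ [y]" N C E "\<Gamma> - 1"]
            by (auto simp: is_path_iff m_def)
          then have "max (activity N x) (activity N y) \<le> m - g"
            using neighbours_activity[OF True] \<Gamma>g by auto
          then show ?thesis using True \<nu> by (simp add: conductance_def \<kappa>_def power_increasing)
        qed (use \<kappa> in \<open>simp add: conductance_def\<close>)
      qed
      have "k * \<nu> ^ g = \<nu> ^ m * (2 / (real (card S) ^ 2 * \<kappa>))" using \<kappa> by (simp add: k_def \<kappa>g)
      also have "\<dots> \<le> \<nu> ^ m * u s" using us \<nu> by (intro mult_left_mono) auto
      also have "\<dots> = \<nu> ^ activity N s * u s" by (simp add: am)
      \<comment> \<open>All terms of the Green sum are nonnegative; only the one at \<open>s\<close>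
        is kept.\<close>
      also have "\<dots> \<le> f s"
        unfolding fs using sS finS \<nu> green_function_nonneg[OF u]
        by (intro member_le_sum[of s "S - A" "\<lambda>x. \<nu> ^ activity N x * u x"]) auto
      finally show ?thesis .
    qed
    ultimately show ?thesis by blast
  qed
  then show "\<exists>k K. 0 < k \<and> 0 < K \<and> (\<forall>\<nu>>1. \<forall>(M :: 'w measure) X.
      markov_process (states N C E) (rate N C \<nu>) s M X \<longrightarrow>
      (\<exists>r. expected_hitting_time M X A = ennreal r \<and> k * \<nu> ^ nat (\<Gamma> - 1) \<le> r \<and> r \<le> K * \<nu> ^ nat (\<Gamma> - 1)))"
    using kK unfolding S_def g_def by blast
qed

section \<open>Passage to logarithms and the maximum over starting states\<close>

lemma elog_tendsto:
  assumes "0 < k" "0 < K"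
    and F: "\<And>\<nu>. \<nu> > 1 \<Longrightarrow> \<exists>r. F \<nu> = ennreal r \<and> k * \<nu> ^ g \<le> r \<and> r \<le> K * \<nu> ^ g"
  shows "((\<lambda>\<nu>. elog \<nu> (F \<nu>)) \<longlongrightarrow> ereal (real g)) at_top"
proof -
  \<comment> \<open>A multiplicative constant contributes \<open>ln c / ln \<nu>\<close> in base
    \<open>\<nu>\<close>, which disappears in the limit.\<close>
  have lim: "((\<lambda>\<nu>. ereal (ln c / ln \<nu> + real g)) \<longlongrightarrow> ereal (real g)) at_top" for c :: real
  proof -
    have "((\<lambda>\<nu>. ln c / ln \<nu> + real g) \<longlongrightarrow> 0 + real g) at_top"
      by (intro tendsto_add tendsto_const tendsto_divide_0[OF tendsto_const]
            filterlim_at_top_imp_at_infinity ln_at_top)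
    then show ?thesis by simp
  qed
  have "\<forall>\<^sub>F \<nu> in at_top. ereal (ln k / ln \<nu> + real g) \<le> elog \<nu> (F \<nu>) \<and>
      elog \<nu> (F \<nu>) \<le> ereal (ln K / ln \<nu> + real g)"
    using eventually_gt_at_top[of "1 :: real"]
  proof eventually_elim
    case (elim \<nu>)
    obtain r where r: "F \<nu> = ennreal r" "k * \<nu> ^ g \<le> r" "r \<le> K * \<nu> ^ g" using F[OF elim] by blast
    have pos: "0 < k * \<nu> ^ g" using assms elim by simp
    \<comment> \<open>Positivity of \<open>r\<close> and finiteness of \<open>ennreal r\<close>
      exclude both exceptional branches of \<open>elog\<close>.\<close>
    have r0: "r > 0" using pos r(2) by linarith
    have eq: "ln (c * \<nu> ^ g) / ln \<nu> = ln c / ln \<nu> + real g" if "c > 0" for c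
      using elim that by (simp add: ln_mult ln_realpow add_divide_distrib)
    have "elog \<nu> (F \<nu>) = ereal (ln r / ln \<nu>)"
      using r0 r(1) by (simp add: elog_def log_def)
    moreover have "ln (k * \<nu> ^ g) / ln \<nu> \<le> ln r / ln \<nu>"
      using pos r(2) r0 elim by (intro divide_right_mono) auto
    moreover have "ln r / ln \<nu> \<le> ln (K * \<nu> ^ g) / ln \<nu>"
      using r(3) r0 elim assms by (intro divide_right_mono) auto
    ultimately show ?case using assms by (simp add: eq)
  qed
  then show ?thesis
    by (intro tendsto_sandwich[OF _ _ lim[of k] lim[of K]]) (auto elim: eventually_mono)
qed

theorem mainTheorem5:
  fixes N C i :: nat
    and E :: "nat \<Rightarrow> (nat \<times> nat) set"
    and M :: "real \<Rightarrow> (nat \<Rightarrow> nat) \<Rightarrow> 'w measure"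
    and X :: "real \<Rightarrow> (nat \<Rightarrow> nat) \<Rightarrow> real \<Rightarrow> 'w \<Rightarrow> (nat \<Rightarrow> nat)"
  assumes "C \<ge> 1"
    and "\<And>c. c \<in> {1..C} \<Longrightarrow> simple_graph {1..N} (E c)"
    and "\<And>\<nu> x. \<nu> > 1 \<Longrightarrow> x \<in> states N C E \<Longrightarrow>
           markov_process (states N C E) (rate N C \<nu>) x (M \<nu> x) (X \<nu> x)"
    and "i \<in> {1..N}"
    and "dominant_active N C E i \<noteq> {}"
    and "dominant_active N C E i \<noteq> dominant N C E"
  shows "((\<lambda>\<nu>. elog \<nu> (Max ((\<lambda>s. expected_hitting_time (M \<nu> s) (X \<nu> s) (dominant_active N C E i)) `
             (dominant N C E - dominant_active N C E i))))
          \<longlongrightarrow> ereal (real_of_int (starvation_index N C E i - 1))) at_top"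
proof -
  define A where "A = dominant_active N C E i"
  define T where "T = dominant N C E - A"
  define \<Gamma> where "\<Gamma> s = Min (comm_height N C E s ` A)" for s
  have A: "A \<subseteq> dominant N C E" "A \<noteq> {}" using assms(5) by (auto simp: A_def dominant_active_def)
  have T: "finite T" "T \<noteq> {}"
    using A assms(6) finite_states[of N C E] by (auto simp: T_def A_def dominant_def)
  have \<Gamma>1: "1 \<le> \<Gamma> s" if "s \<in> T" for s
    unfolding \<Gamma>_def using expected_hitting_time_bounds(1)[OF A] that by (simp add: T_def)
  have "\<exists>k K. 0 < k \<and> 0 < K \<and> (\<forall>\<nu>>1. \<exists>r. expected_hitting_time (M \<nu> s) (X \<nu> s) A = ennreal r \<and>
      k * \<nu> ^ nat (\<Gamma> s - 1) \<le> r \<and> r \<le> K * \<nu> ^ nat (\<Gamma> s - 1))" if "s \<in> T" for s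
  proof -
    have "s \<in> states N C E" using that by (auto simp: T_def dominant_def)
    then show ?thesis
      using expected_hitting_time_bounds(2)[OF A, of s, where 'w = 'w] assms(3) that
      unfolding T_def \<Gamma>_def by meson
  qed
  then obtain k K where kK: "\<And>s. s \<in> T \<Longrightarrow> 0 < k s" "\<And>s. s \<in> T \<Longrightarrow> 0 < K s"
    and bnd: "\<And>s \<nu>. s \<in> T \<Longrightarrow> \<nu> > 1 \<Longrightarrow> \<exists>r. expected_hitting_time (M \<nu> s) (X \<nu> s) A = ennreal r \<and>
      k s * \<nu> ^ nat (\<Gamma> s - 1) \<le> r \<and> r \<le> K s * \<nu> ^ nat (\<Gamma> s - 1)"
    by metis
  define g where "g = nat (Max (\<Gamma> ` T) - 1)"
  have "Max (\<Gamma> ` T) \<in> \<Gamma> ` T" using T by (intro Max_in) auto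
  then obtain t where t: "t \<in> T" "Max (\<Gamma> ` T) = \<Gamma> t" by blast
  have gt: "g = nat (\<Gamma> t - 1)" by (simp add: g_def t)
  have index: "starvation_index N C E i - 1 = int g"
  proof -
    have "starvation_index N C E i = Max (\<Gamma> ` T)"
      by (simp add: starvation_index_def \<Gamma>_def T_def A_def)
    \<comment> \<open>\<open>1 \<le> \<Gamma> t\<close> prevents truncation by
      \<open>nat\<close>.\<close>
    then show ?thesis using \<Gamma>1[OF t(1)] t(2) by (simp add: g_def)
  qed
  \<comment> \<open>The state attaining the maximal expectation may vary with \<open>\<nu>\<close>:
    the lower bound uses the fixed \<open>t\<close> of largest exponent, the upper bound a constant
    dominating every \<open>K s\<close>.\<close>
  have "((\<lambda>\<nu>. elog \<nu> (Max ((\<lambda>s. expected_hitting_time (M \<nu> s) (X \<nu> s) A) ` T))) \<longlongrightarrow> ereal (real g)) at_top"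
  proof (rule elog_tendsto)
    show "0 < k t" using kK t by simp
    show "0 < (\<Sum>s\<in>T. K s)" using T kK by (intro sum_pos) auto
    fix \<nu> :: real assume \<nu>: "\<nu> > 1"
    let ?F = "\<lambda>s. expected_hitting_time (M \<nu> s) (X \<nu> s) A"
    have "Max (?F ` T) \<in> ?F ` T" using T by (intro Max_in) auto
    then obtain s where s: "s \<in> T" "Max (?F ` T) = ?F s" by blast
    obtain r where r: "?F s = ennreal r" "k s * \<nu> ^ nat (\<Gamma> s - 1) \<le> r" "r \<le> K s * \<nu> ^ nat (\<Gamma> s - 1)"
      using bnd[OF s(1) \<nu>] by blast
    obtain r' where r': "?F t = ennreal r'" "k t * \<nu> ^ g \<le> r'"
      using bnd[OF t(1) \<nu>] gt by blast
    have "0 \<le> k s * \<nu> ^ nat (\<Gamma> s - 1)" using kK(1)[OF s(1)] \<nu> by simp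
    then have "r \<ge> 0" using r(2) by linarith
    moreover have "?F t \<le> ?F s" unfolding s(2)[symmetric] using T t by (intro Max_ge) auto
    ultimately have "r' \<le> r" by (simp add: r r')
    moreover have "r \<le> (\<Sum>s\<in>T. K s) * \<nu> ^ g"
    proof -
      have "\<Gamma> s \<le> \<Gamma> t" unfolding t(2)[symmetric] using T s by (intro Max_ge) auto
      then have "\<nu> ^ nat (\<Gamma> s - 1) \<le> \<nu> ^ g" using \<nu> by (intro power_increasing) (auto simp: gt)
      moreover have "K s \<le> (\<Sum>s\<in>T. K s)"
        using T s kK by (intro member_le_sum) (auto simp: less_imp_le)
      ultimately have "K s * \<nu> ^ nat (\<Gamma> s - 1) \<le> (\<Sum>s\<in>T. K s) * \<nu> ^ g"
        using kK s \<nu> T by (intro mult_mono sum_nonneg) (auto simp: less_imp_le)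
      then show ?thesis using r(3) by linarith
    qed
    ultimately show "\<exists>r. Max (?F ` T) = ennreal r \<and> k t * \<nu> ^ g \<le> r \<and> r \<le> (\<Sum>s\<in>T. K s) * \<nu> ^ g"
      using s(2) r(1) r'(2) by (intro exI[of _ r]) auto
  qed
  then show ?thesis by (simp add: T_def A_def index)
qed

end
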